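(* Let $N\in\mathbb{N}$ and let real coefficients $\gamma_1,\ldots,\gamma_N$ satisfy $$\Big|\sum_{n=K}^N\gamma_n\Big|<1\quad\text{for each } K=1,2,\ldots,N,$$ and $$\sum_{n=K}^M\gamma_n\neq0\quad\text{for each }K=2,3,\ldots,M\text{ and each } M=2,3,\ldots,N.$$ Consider the stationary system $$E w_n = w_{n+1}+w_{n-1}+i\gamma_n w_n+|w_n|^2 w_n,\quad 1\le n\le N,\qquad w_0=\bar w_1,\quad w_{N+1}=0.$$ Then, besides the stationary solutions of families (A) and (B) described in the context, no other stationary solutions of this system exist for sufficiently large $E$.
   Context: Here $E$ is a real parameter, taken large and positive, and the unknown is $(w_1,\ldots,w_N)\in\mathbb{C}^N$. Extending by $w_{1-n}=\bar w_n$ for $1\le n\le N$, solutions correspond to $\mathcal{PT}$-invariant stationary modes of a $2N$-site $\mathcal{PT}$-symmetric discrete nonlinear Schrödinger network. A stationary solution means a nonzero solution (the zero equilibrium is not counted). Solutions are identified up to the gauge transformation $\mathbf{w}\mapsto-\mathbf{w}$. The known families are as follows. (A) If $|\sum_{n=K}^N\gamma_n|<1$ for each $K=1,\ldots,N$, the system admits in the limit of large positive $E$ $2^N$ solutions (unique up to a gauge transformation) such that, for sufficiently large $E$, the map $E\mapsto\mathbf{w}$ is $C^\infty$ at each solution and there is an $E$-independent constant $C>0$ with $\big||w_n|^2-E\big|\le C$ for each $n=1,\ldots,N$. (B) (For $N\ge2$.) For $M\in\{1,\ldots,N-1\}$, if $|\sum_{n=K}^M\gamma_n|<1$ for each $K=1,\ldots,M$,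 the system admits in the limit of large positive $E$ $2^M$ solutions (unique up to a gauge transformation) such that, for sufficiently large $E$, the map $E\mapsto\mathbf{w}$ is $C^\infty$ at each solution and there is an $E$-independent constant $C>0$ with $\big||w_n|^2-E\big|\le C$ for $n=1,\ldots,M$ and $|w_n|^2\le CE^{-1}$ for $n=M+1,\ldots,N$.
   Formalization: The claim fails if for some M<N all |γ_K+…+γ_M| ≤ 1 (1≤K≤M) with equality for some K, e.g. N=2, γ=(1,−1/2); for such M, further solutions obeying the bounds of (B) are not excluded. *)

theory Defs
  imports "HOL-Analysis.Analysis"
begin

text \<open>
  A vector \<open>(w\<^sub>1, \<dots>, w\<^sub>N)\<close> is encoded as a function \<open>w :: nat \<Rightarrow> complex\<close> that also carries the
  boundary values \<open>w 0\<close> and \<open>w (N + 1)\<close>; values beyond \<open>N + 1\<close> are irrelevant, so vectors are only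
  ever compared on \<open>{1..N}\<close>.
\<close>

definition stationary_solution :: "(nat \<Rightarrow> real) \<Rightarrow> nat \<Rightarrow> real \<Rightarrow> (nat \<Rightarrow> complex) \<Rightarrow> bool" where
  "stationary_solution \<gamma> N E w \<longleftrightarrow>
     w 0 = cnj (w 1) \<and> w (N + 1) = 0 \<and>
     (\<forall>n\<in>{1..N}. of_real E * w n =
        w (n + 1) + w (n - 1) + \<i> * of_real (\<gamma> n) * w n + of_real ((cmod (w n))\<^sup>2) * w n) \<and>
     (\<exists>n\<in>{1..N}. w n \<noteq> 0)"

definition gauge_equivalent :: "nat \<Rightarrow> (nat \<Rightarrow> complex) \<Rightarrow> (nat \<Rightarrow> complex) \<Rightarrow> bool" where
  "gauge_equivalent N v w \<longleftrightarrow>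
     (\<forall>n\<in>{1..N}. v n = w n) \<or> (\<forall>n\<in>{1..N}. v n = - w n)"

definition smooth_on_ray :: "real \<Rightarrow> (real \<Rightarrow> complex) \<Rightarrow> bool" where
  "smooth_on_ray E0 f \<longleftrightarrow>
     (\<exists>D :: nat \<Rightarrow> real \<Rightarrow> complex.
        (\<forall>E>E0. D 0 E = f E) \<and>
        (\<forall>k. \<forall>E>E0. (D k has_vector_derivative D (Suc k) E) (at E)))"

text \<open>The hypothesis of (B) for given \<open>M\<close>, and that of (A) when \<open>M = N\<close>.\<close>

definition admissible :: "(nat \<Rightarrow> real) \<Rightarrow> nat \<Rightarrow> bool" where
  "admissible \<gamma> M \<longleftrightarrow> (\<forall>K\<in>{1..M}. \<bar>\<Sum>n=K..M. \<gamma> n\<bar> < 1)"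

text \<open>
  Boundary case of the hypothesis of (B). For critical \<open>M < N\<close>, (B) does not apply, yet solutions
  obeying its bounds can exist for all large \<open>E\<close>: take \<open>N = 2\<close>, \<open>\<gamma>\<^sub>1 = 1\<close>, \<open>\<gamma>\<^sub>2 = - 1 / 2\<close>,
  \<open>M = 1\<close>, where \<open>w\<^sub>2 = r w\<^sub>1\<close> with \<open>r\<close> close to \<open>1 / E\<close>, \<open>|w\<^sub>1|\<^sup>2\<close> close to \<open>E\<close> and
  \<open>sin (2 arg w\<^sub>1) = 1 - |r|\<^sup>2 / 2\<close>. A list of all solutions therefore has to allow for them.
\<close>

definition critical :: "(nat \<Rightarrow> real) \<Rightarrow> nat \<Rightarrow> bool" where
  "critical \<gamma> M \<longleftrightarrow>
     (\<forall>K\<in>{1..M}. \<bar>\<Sum>n=K..M. \<gamma> n\<bar> \<le> 1) \<and> (\<exists>K\<in>{1..M}. \<bar>\<Sum>n=K..M. \<gamma> n\<bar> = 1)"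

text \<open>The bounds of (B) for \<open>M < N\<close>; for \<open>M = N\<close> the second conjunct is void and this is (A).\<close>

definition asymptotic_bounds :: "nat \<Rightarrow> nat \<Rightarrow> real \<Rightarrow> real \<Rightarrow> (nat \<Rightarrow> complex) \<Rightarrow> bool" where
  "asymptotic_bounds N M C E w \<longleftrightarrow>
     (\<forall>n\<in>{1..M}. \<bar>(cmod (w n))\<^sup>2 - E\<bar> \<le> C) \<and>
     (\<forall>n\<in>{M+1..N}. (cmod (w n))\<^sup>2 \<le> C / E)"

text \<open>
  \<open>F\<close> enumerates, one representative per gauge class, the \<open>2 ^ M\<close> solution branches of family (B)
  for \<open>M < N\<close>, and of family (A) for \<open>M = N\<close>; \<open>F i E\<close> is the \<open>i\<close>-th solution at the parameter \<open>E\<close>.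
\<close>

definition solution_family ::
    "(nat \<Rightarrow> real) \<Rightarrow> nat \<Rightarrow> nat \<Rightarrow> real \<Rightarrow> real \<Rightarrow> (nat \<Rightarrow> real \<Rightarrow> nat \<Rightarrow> complex) \<Rightarrow> bool" where
  "solution_family \<gamma> N M E0 C F \<longleftrightarrow>
     (\<forall>i<2 ^ M.
        (\<forall>E>E0. stationary_solution \<gamma> N E (F i E) \<and> asymptotic_bounds N M C E (F i E)) \<and>
        (\<forall>n\<in>{1..N}. smooth_on_ray E0 (\<lambda>E. F i E n))) \<and>
     (\<forall>E>E0. \<forall>i<2 ^ M. \<forall>j<2 ^ M. i \<noteq> j \<longrightarrow> \<not> gauge_equivalent N (F i E) (F j E))"

end

theory Submission
  imports Defs "HOL-Complex_Analysis.Complex_Analysis"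
begin

text \<open>
  By the maximum principle every component of a stationary solution satisfies \<open>|w\<^sub>n|\<^sup>2 = E + O(1)\<close> or
  \<open>|w\<^sub>n|\<^sup>2 = O(1/E)\<close>. The balance \<open>Im (w\<^sub>n cnj w\<^sub>n\<^sub>-\<^sub>1) = Im (w\<^sub>n\<^sub>+\<^sub>1 cnj w\<^sub>n) + \<gamma>\<^sub>n |w\<^sub>n|\<^sup>2\<close>, summed
  over a block \<open>K..M\<close> of large sites, makes \<open>E |\<gamma>\<^sub>K + \<dots> + \<gamma>\<^sub>M|\<close> bounded if both neighbours of the
  block are small, so the nonvanishing of these sums forces the large sites to be \<open>1..M\<close> for some
  \<open>M\<close>; and \<open>|w\<^sub>K\<^sub>-\<^sub>1 w\<^sub>K| \<le> E + O(1)\<close> then yields \<open>|\<gamma>\<^sub>K + \<dots> + \<gamma>\<^sub>M| \<le> 1\<close>.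

  For an admissible \<open>M\<close> and a choice of the signs of \<open>Re (w\<^sub>n cnj w\<^sub>n\<^sub>-\<^sub>1)\<close>, \<open>1 \<le> n \<le> M\<close>, the gauge
  invariant quantities of a solution form a fixed point \<open>u = F e u\<close>, \<open>e = 1/E\<close>, where \<open>F\<close> is
  holomorphic and equal to a constant plus \<open>O(e)\<close>. For small \<open>e\<close> it is a contraction, also for complex
  \<open>e\<close>, so the fixed point is unique and depends holomorphically on \<open>e\<close>; this gives the \<open>2\<^sup>M\<close> smooth
  branches together with their completeness.
\<close>

text \<open>The unknowns are gauge invariant because they determine \<open>w 1\<close> only through
  its square; the choice of root is exactly the gauge freedom. Every unknown enters \<open>F\<close>
  with a factor \<open>e\<close>, so at \<open>e = 0\<close> the system is solved explicitly and no
  Jacobian has to be inverted. Complex \<open>e\<close> is the source of smoothness: Picard iterates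
  are holomorphic and converge uniformly, whereas a real iteration would need estimates for all
  derivatives. Strictness of the bounds on the sums keeps \<open>csqrt\<close> off its branch point,
  since the limit of \<open>X\<^sup>2\<close> is 1 minus a squared sum. For a critical
  \<open>M\<close> this limit vanishes at some site and the construction breaks down; such solutions
  form a separate alternative of the theorem. The number 32 is at once the bound that the
  classification delivers, the radius of the polydisc of the contraction and the constant of the
  families. Because these agree, uniqueness of the fixed point yields completeness.\<close>

lemma smooth_on_ray_holomorphic:
  assumes "h holomorphic_on {z. Re z > E0}" and "\<And>E. E > E0 \<Longrightarrow> h (of_real E) = f E"
  shows "smooth_on_ray E0 f"
  unfolding smooth_on_ray_def
proof (intro exI[of _ "\<lambda>k E. (deriv ^^ k) h (of_real E)"] conjI allI impI)
  fix k :: nat and E :: real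
  assume "E > E0"
  have "open {z. Re z > E0}"
    by (simp add: open_halfspace_Re_gt)
  then have "((deriv ^^ k) h has_field_derivative (deriv ^^ Suc k) h (of_real E)) (at (of_real E))"
    using holomorphic_derivI[OF holomorphic_higher_deriv[OF assms(1)], of "of_real E" k] \<open>E > E0\<close>
    by simp
  then show "((\<lambda>E. (deriv ^^ k) h (of_real E)) has_vector_derivative
      (deriv ^^ Suc k) h (of_real E)) (at E)"
    by (rule has_vector_derivative_real_field)
qed (use assms(2) in simp)

section \<open>Holomorphic perturbations of constants\<close>

text \<open>Coordinates outside \<open>I\<close> are free, so fixed points are only ever compared on
  \<open>I\<close>; \<open>near_const_local\<close> bridges this gap.\<close>

definition polydisc :: "'i set \<Rightarrow> real \<Rightarrow> ('i \<Rightarrow> complex) set" where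
  "polydisc I R = {u. \<forall>i\<in>I. norm (u i) \<le> R}"

text \<open>The third clause asks for holomorphy in \<open>e\<close> along holomorphic families
  \<open>g\<close> only. This is all that an iteration in \<open>u\<close> uses, and it avoids
  holomorphy in several variables.\<close>

definition near_const_within ::
    "'i set \<Rightarrow> real \<Rightarrow> real \<Rightarrow> real \<Rightarrow> complex \<Rightarrow> (complex \<Rightarrow> ('i \<Rightarrow> complex) \<Rightarrow> complex) \<Rightarrow> bool" where
  "near_const_within I R \<delta> B c f \<longleftrightarrow>
     (\<forall>e u. norm e < \<delta> \<longrightarrow> u \<in> polydisc I R \<longrightarrow> norm (f e u - c) \<le> B * norm e) \<and>
     (\<forall>e u v d. norm e < \<delta> \<longrightarrow> u \<in> polydisc I R \<longrightarrow> v \<in> polydisc I R \<longrightarrow> d \<ge> 0 \<longrightarrow>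
        (\<forall>i\<in>I. norm (u i - v i) \<le> d) \<longrightarrow> norm (f e u - f e v) \<le> B * norm e * d) \<and>
     (\<forall>g S. open S \<longrightarrow> S \<subseteq> ball 0 \<delta> \<longrightarrow> (\<forall>i\<in>I. g i holomorphic_on S) \<longrightarrow>
        (\<forall>e\<in>S. (\<lambda>i. g i e) \<in> polydisc I R) \<longrightarrow> (\<lambda>e. f e (\<lambda>i. g i e)) holomorphic_on S)"

text \<open>Holomorphic perturbations of the constant \<open>c\<close>: \<open>f e u = c + O(e)\<close> on every polydisc, with a
  Lipschitz constant in \<open>u\<close> that is itself \<open>O(e)\<close>.\<close>

definition near_const :: "'i set \<Rightarrow> complex \<Rightarrow> (complex \<Rightarrow> ('i \<Rightarrow> complex) \<Rightarrow> complex) \<Rightarrow> bool" where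
  "near_const I c f \<longleftrightarrow> (\<forall>R>0. \<exists>\<delta>>0. \<exists>B>0. near_const_within I R \<delta> B c f)"

lemma near_const_withinD:
  assumes "near_const_within I R \<delta> B c f"
  shows "norm e < \<delta> \<Longrightarrow> u \<in> polydisc I R \<Longrightarrow> norm (f e u - c) \<le> B * norm e"
    and "norm e < \<delta> \<Longrightarrow> u \<in> polydisc I R \<Longrightarrow> v \<in> polydisc I R \<Longrightarrow> d \<ge> 0 \<Longrightarrow>
      (\<And>i. i \<in> I \<Longrightarrow> norm (u i - v i) \<le> d) \<Longrightarrow> norm (f e u - f e v) \<le> B * norm e * d"
    and "open S \<Longrightarrow> S \<subseteq> ball 0 \<delta> \<Longrightarrow> (\<And>i. i \<in> I \<Longrightarrow> g i holomorphic_on S) \<Longrightarrow>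
      (\<And>e. e \<in> S \<Longrightarrow> (\<lambda>i. g i e) \<in> polydisc I R) \<Longrightarrow> (\<lambda>e. f e (\<lambda>i. g i e)) holomorphic_on S"
  using assms unfolding near_const_within_def by simp_all

lemma near_const_within_mono:
  assumes "near_const_within I R \<delta> B c f" "\<delta>' \<le> \<delta>" "B \<le> B'"
  shows "near_const_within I R \<delta>' B' c f"
  unfolding near_const_within_def
proof (intro conjI allI impI)
  fix e :: complex and u assume "norm e < \<delta>'" "u \<in> polydisc I R"
  then have "norm (f e u - c) \<le> B * norm e"
    using assms unfolding near_const_within_def by auto
  also have "\<dots> \<le> B' * norm e"
    using assms by (intro mult_right_mono) auto
  finally show "norm (f e u - c) \<le> B' * norm e" .
next
  fix e :: complex and u v d
  assume "norm e < \<delta>'" "u \<in> polydisc I R" "v \<in> polydisc I R" "d \<ge> 0" "\<forall>i\<in>I. norm (u i - v i) \<le> d"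
  then have "norm (f e u - f e v) \<le> B * norm e * d"
    using assms unfolding near_const_within_def by auto
  also have "\<dots> \<le> B' * norm e * d"
    using assms \<open>d \<ge> 0\<close> by (intro mult_right_mono) auto
  finally show "norm (f e u - f e v) \<le> B' * norm e * d" .
next
  fix g S assume "open S" "S \<subseteq> ball (0::complex) \<delta>'" "\<forall>i\<in>I. g i holomorphic_on S"
    "\<forall>e\<in>S. (\<lambda>i. g i e) \<in> polydisc I R"
  moreover from this have "S \<subseteq> ball 0 \<delta>"
    using assms by auto
  ultimately show "(\<lambda>e. f e (\<lambda>i. g i e)) holomorphic_on S"
    using assms(1) unfolding near_const_within_def by blast
qed

lemma near_const_const: "near_const I c (\<lambda>e u. c)"
  unfolding near_const_def near_const_within_def
  by (intro allI impI exI[of _ 1] conjI) auto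

lemma near_const_e: "near_const I 0 (\<lambda>e u. e)"
  unfolding near_const_def near_const_within_def
  by (intro allI impI exI[of _ 1] conjI) auto

text \<open>The unknowns enter the system only in this form; the factor \<open>e\<close> is what
  makes the Lipschitz constants small.\<close>

lemma near_const_e_mult_var:
  fixes I :: "'i set"
  assumes "i \<in> I"
  shows "near_const I 0 (\<lambda>e u. e * u i)"
  unfolding near_const_def
proof (intro allI impI)
  fix R :: real assume "R > 0"
  have "near_const_within I R 1 (R + 1) 0 (\<lambda>e u. e * u i)"
    unfolding near_const_within_def
  proof (intro conjI allI impI)
    fix e :: complex and u :: "'i \<Rightarrow> complex"
    assume "u \<in> polydisc I R"
    then have "norm (u i) \<le> R"
      using assms by (simp add: polydisc_def)
    then have "norm (u i) \<le> R + 1"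
      by simp
    then show "norm (e * u i - 0) \<le> (R + 1) * norm e"
      using mult_right_mono[of "norm (u i)" "R + 1" "norm e"] by (simp add: norm_mult mult.commute)
  next
    fix e :: complex and u v :: "'i \<Rightarrow> complex" and d :: real
    assume "d \<ge> 0" "\<forall>i\<in>I. norm (u i - v i) \<le> d"
    then have "norm (u i - v i) \<le> d" "0 \<le> R * norm e * d"
      using assms \<open>R > 0\<close> by auto
    then have "norm (e * (u i - v i)) \<le> R * norm e * d + norm e * d"
      unfolding norm_mult by (intro add_increasing mult_left_mono) auto
    then show "norm (e * u i - e * v i) \<le> (R + 1) * norm e * d"
      by (simp add: algebra_simps)
  qed (use assms in \<open>auto intro!: holomorphic_intros\<close>)
  moreover have "R + 1 > 0"
    using \<open>R > 0\<close> by simp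
  ultimately show "\<exists>\<delta>>0. \<exists>B>0. near_const_within I R \<delta> B 0 (\<lambda>e u. e * u i)"
    using zero_less_one by blast
qed

lemma near_const_add:
  assumes "near_const I c f" "near_const I c' f'"
  shows "near_const I (c + c') (\<lambda>e u. f e u + f' e u)"
  unfolding near_const_def
proof (intro allI impI)
  fix R :: real assume "R > 0"
  obtain \<delta> B where 1: "\<delta> > 0" "B > 0" "near_const_within I R \<delta> B c f"
    using assms(1) \<open>R > 0\<close> unfolding near_const_def by blast
  obtain \<delta>' B' where 2: "\<delta>' > 0" "B' > 0" "near_const_within I R \<delta>' B' c' f'"
    using assms(2) \<open>R > 0\<close> unfolding near_const_def by blast
  define \<eta> where "\<eta> = min \<delta> \<delta>'"
  have f: "near_const_within I R \<eta> B c f" and f': "near_const_within I R \<eta> B' c' f'"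
    using near_const_within_mono[OF 1(3), of \<eta> B] near_const_within_mono[OF 2(3), of \<eta> B']
    by (auto simp: \<eta>_def)
  have "near_const_within I R \<eta> (B + B') (c + c') (\<lambda>e u. f e u + f' e u)"
    unfolding near_const_within_def
  proof (intro conjI allI impI)
    fix e :: complex and u assume "norm e < \<eta>" "u \<in> polydisc I R"
    then have "norm (f e u - c) \<le> B * norm e" "norm (f' e u - c') \<le> B' * norm e"
      using f f' unfolding near_const_within_def by auto
    then show "norm (f e u + f' e u - (c + c')) \<le> (B + B') * norm e"
      unfolding add_diff_add ring_distribs by (rule norm_triangle_mono)
  next
    fix e :: complex and u v d
    assume "norm e < \<eta>" "u \<in> polydisc I R" "v \<in> polydisc I R" "d \<ge> 0" "\<forall>i\<in>I. norm (u i - v i) \<le> d"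
    then have "norm (f e u - f e v) \<le> B * norm e * d" "norm (f' e u - f' e v) \<le> B' * norm e * d"
      using f f' unfolding near_const_within_def by auto
    then show "norm (f e u + f' e u - (f e v + f' e v)) \<le> (B + B') * norm e * d"
      unfolding add_diff_add ring_distribs by (rule norm_triangle_mono)
  next
    fix g S assume "open S" "S \<subseteq> ball (0::complex) \<eta>" "\<forall>i\<in>I. g i holomorphic_on S"
      "\<forall>e\<in>S. (\<lambda>i. g i e) \<in> polydisc I R"
    then have "(\<lambda>e. f e (\<lambda>i. g i e)) holomorphic_on S" "(\<lambda>e. f' e (\<lambda>i. g i e)) holomorphic_on S"
      using near_const_withinD(3)[OF f] near_const_withinD(3)[OF f'] by simp_all
    then show "(\<lambda>e. f e (\<lambda>i. g i e) + f' e (\<lambda>i. g i e)) holomorphic_on S"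
      by (intro holomorphic_intros)
  qed
  moreover have "\<eta> > 0" "B + B' > 0"
    using 1 2 by (auto simp: \<eta>_def)
  ultimately show "\<exists>\<delta>>0. \<exists>B>0. near_const_within I R \<delta> B (c + c') (\<lambda>e u. f e u + f' e u)"
    by blast
qed

text \<open>The derivative is bounded on a compact ball, and convexity of the ball gives the mean
  value estimate.\<close>

lemma holomorphic_locally_lipschitz:
  assumes "h holomorphic_on S" "open S" "c \<in> S"
  obtains r L where "r > 0" "L > 0" "ball c r \<subseteq> S"
    "\<And>x y. x \<in> ball c r \<Longrightarrow> y \<in> ball c r \<Longrightarrow> norm (h x - h y) \<le> L * norm (x - y)"
proof -
  obtain r where r: "r > 0" "cball c r \<subseteq> S"
    using assms(2,3) open_contains_cball by blast
  have "continuous_on (cball c r) (deriv h)"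
    using holomorphic_on_imp_continuous_on[OF holomorphic_deriv[OF assms(1,2)]] r(2)
    by (rule continuous_on_subset)
  then have "bounded (deriv h ` cball c r)"
    by (intro compact_imp_bounded compact_continuous_image) auto
  then obtain L where L: "L > 0" "\<And>z. z \<in> cball c r \<Longrightarrow> norm (deriv h z) \<le> L"
    unfolding bounded_pos by auto
  have "norm (h x - h y) \<le> L * norm (x - y)" if "x \<in> ball c r" "y \<in> ball c r" for x y
  proof (rule field_differentiable_bound[of "ball c r" h "deriv h"])
    show "(h has_field_derivative deriv h z) (at z within ball c r)" if "z \<in> ball c r" for z
      using holomorphic_derivI[OF assms(1,2), of z] r(2) that ball_subset_cball by blast
  qed (use L that in auto)
  then show ?thesis
    using that[of r L] r L ball_subset_cball by blast
qed

lemma near_const_compose: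
  assumes f: "near_const I c f" and h: "h holomorphic_on S" "open S" "c \<in> S"
  shows "near_const I (h c) (\<lambda>e u. h (f e u))"
  unfolding near_const_def
proof (intro allI impI)
  fix R :: real assume "R > 0"
  obtain r L where L: "r > 0" "L > 0" "ball c r \<subseteq> S"
    "\<And>x y. x \<in> ball c r \<Longrightarrow> y \<in> ball c r \<Longrightarrow> norm (h x - h y) \<le> L * norm (x - y)"
    using holomorphic_locally_lipschitz[OF h] by metis
  obtain \<delta> B where B: "\<delta> > 0" "B > 0" "near_const_within I R \<delta> B c f"
    using f \<open>R > 0\<close> unfolding near_const_def by blast
  \<comment> \<open>Below \<open>r / B\<close> the values of \<open>f\<close> stay within
    \<open>r\<close> of \<open>c\<close>, where \<open>h\<close> is Lipschitz.\<close>
  define \<eta> where "\<eta> = min \<delta> (r / B)"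
  have f: "near_const_within I R \<eta> B c f"
    using near_const_within_mono[OF B(3), of \<eta> B] by (auto simp: \<eta>_def)
  have mem: "f e u \<in> ball c r" if "norm e < \<eta>" "u \<in> polydisc I R" for e u
  proof -
    have "norm (f e u - c) \<le> B * norm e"
      using f that unfolding near_const_within_def by auto
    also have "\<dots> < r"
      using that(1) \<open>B > 0\<close> by (auto simp: \<eta>_def field_simps)
    finally show ?thesis
      by (simp add: dist_norm norm_minus_commute)
  qed
  have "near_const_within I R \<eta> (L * B) (h c) (\<lambda>e u. h (f e u))"
    unfolding near_const_within_def
  proof (intro conjI allI impI)
    fix e :: complex and u assume *: "norm e < \<eta>" "u \<in> polydisc I R"
    have "norm (h (f e u) - h c) \<le> L * norm (f e u - c)"
      using L(1,4) mem[OF *] by simp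
    also have "\<dots> \<le> L * (B * norm e)"
      using f * L(2) unfolding near_const_within_def by (intro mult_left_mono) auto
    finally show "norm (h (f e u) - h c) \<le> L * B * norm e"
      by (simp add: mult.assoc)
  next
    fix e :: complex and u v d
    assume *: "norm e < \<eta>" "u \<in> polydisc I R" "v \<in> polydisc I R" "d \<ge> 0" "\<forall>i\<in>I. norm (u i - v i) \<le> d"
    have "norm (h (f e u) - h (f e v)) \<le> L * norm (f e u - f e v)"
      using L(4) mem * by blast
    also have "\<dots> \<le> L * (B * norm e * d)"
      using f * L(2) unfolding near_const_within_def by (intro mult_left_mono) auto
    finally show "norm (h (f e u) - h (f e v)) \<le> L * B * norm e * d"
      by (simp add: mult.assoc)
  next
    fix g T assume *: "open T" "T \<subseteq> ball (0::complex) \<eta>" "\<forall>i\<in>I. g i holomorphic_on T"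
      "\<forall>e\<in>T. (\<lambda>i. g i e) \<in> polydisc I R"
    then have "(\<lambda>e. f e (\<lambda>i. g i e)) holomorphic_on T"
      using near_const_withinD(3)[OF f] by simp
    moreover have "(\<lambda>e. f e (\<lambda>i. g i e)) ` T \<subseteq> S"
      using mem * L(3) by (auto simp: subset_iff)
    ultimately show "(\<lambda>e. h (f e (\<lambda>i. g i e))) holomorphic_on T"
      using holomorphic_on_compose_gen[OF _ h(1)] by (simp add: o_def)
  qed
  moreover have "\<eta> > 0" "L * B > 0"
    using B L by (auto simp: \<eta>_def)
  ultimately show "\<exists>\<delta>>0. \<exists>B>0. near_const_within I R \<delta> B (h c) (\<lambda>e u. h (f e u))"
    by blast
qed

lemma near_const_cmult:
  "near_const I c f \<Longrightarrow> near_const I (k * c) (\<lambda>e u. k * f e u)"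
  by (rule near_const_compose[where h="\<lambda>z. k * z" and S=UNIV]) (auto intro!: holomorphic_intros)

lemma near_const_diff:
  assumes "near_const I c f" "near_const I c' f'"
  shows "near_const I (c - c') (\<lambda>e u. f e u - f' e u)"
  using near_const_add[OF assms(1) near_const_cmult[OF assms(2), of "-1"]] by simp

lemma near_const_power2:
  "near_const I c f \<Longrightarrow> near_const I (c\<^sup>2) (\<lambda>e u. (f e u)\<^sup>2)"
  by (rule near_const_compose[where h="\<lambda>z. z\<^sup>2" and S=UNIV]) (auto intro!: holomorphic_intros)

text \<open>Polarisation expresses a product through squares, and squaring is a composition with a
  function of one variable.\<close>

lemma near_const_mult:
  assumes "near_const I c f" "near_const I c' f'"
  shows "near_const I (c * c') (\<lambda>e u. f e u * f' e u)"
proof -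
  have polarisation: "1 / 4 * ((x + y)\<^sup>2 - (x - y)\<^sup>2) = x * y" for x y :: complex
    by (simp add: power2_eq_square algebra_simps)
  show ?thesis
    using near_const_cmult[OF near_const_diff[OF near_const_power2[OF near_const_add[OF assms]]
          near_const_power2[OF near_const_diff[OF assms]]], of "1 / 4"]
    unfolding polarisation .
qed

lemma near_const_divide:
  assumes "near_const I c f" "near_const I c' f'" "c' \<noteq> 0"
  shows "near_const I (c / c') (\<lambda>e u. f e u / f' e u)"
proof -
  have "near_const I (inverse c') (\<lambda>e u. inverse (f' e u))"
    by (rule near_const_compose[OF assms(2), of inverse "- {0}"])
       (use assms(3) in \<open>auto intro!: holomorphic_intros\<close>)
  from near_const_mult[OF assms(1) this] show ?thesis
    by (simp add: divide_inverse)
qed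

text \<open>\<open>Re c > 0\<close> keeps the values off the branch cut for small \<open>e\<close>.
  Applied to \<open>P\<close>, this requirement becomes \<open>(flux n)\<^sup>2 < 1\<close>.\<close>

lemma near_const_csqrt:
  assumes "near_const I c f" "Re c > 0"
  shows "near_const I (csqrt c) (\<lambda>e u. csqrt (f e u))"
  using assms(1)
proof (rule near_const_compose)
  show "csqrt holomorphic_on {z. Re z > 0}"
    by (rule holomorphic_on_subset[OF holomorphic_on_csqrt]) (auto elim!: nonpos_Reals_cases)
qed (use assms(2) in \<open>auto simp: open_halfspace_Re_gt\<close>)

lemma near_const_sum:
  assumes "\<And>k. k \<in> A \<Longrightarrow> near_const I (c k) (f k)"
  shows "near_const I (\<Sum>k\<in>A. c k) (\<lambda>e u. \<Sum>k\<in>A. f k e u)"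
  using assms
  by (induction A rule: infinite_finite_induct) (auto intro: near_const_const near_const_add)

lemma near_const_prod:
  assumes "\<And>k. k \<in> A \<Longrightarrow> near_const I (c k) (f k)"
  shows "near_const I (\<Prod>k\<in>A. c k) (\<lambda>e u. \<Prod>k\<in>A. f k e u)"
  using assms
  by (induction A rule: infinite_finite_induct) (auto intro: near_const_const near_const_mult)

lemmas near_const_intros = near_const_const near_const_e near_const_e_mult_var near_const_add
  near_const_diff near_const_power2 near_const_mult near_const_divide near_const_csqrt
  near_const_sum near_const_prod

text \<open>The filter at 0 lets finitely many smallness conditions on the radius be intersected
  without explicit minima.\<close>

lemma near_const_eventually:
  assumes "near_const I c f" "R > 0"
  obtains B where "B > 0" "\<forall>\<^sub>F \<eta> in at_right 0. near_const_within I R \<eta> B c f"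
proof -
  obtain \<delta> B where B: "\<delta> > 0" "B > 0" "near_const_within I R \<delta> B c f"
    using assms unfolding near_const_def by blast
  then have "\<forall>\<^sub>F \<eta> in at_right 0. near_const_within I R \<eta> B c f"
    unfolding eventually_at_right_field
    by (intro exI[of _ \<delta>]) (auto intro: near_const_within_mono)
  with B(2) show ?thesis
    by (rule that)
qed

lemma near_const_Re_pos:
  assumes "near_const I c f" "R > 0" "Re c > 0"
  shows "\<forall>\<^sub>F \<eta> in at_right 0. \<forall>e u. norm e < \<eta> \<longrightarrow> u \<in> polydisc I R \<longrightarrow> Re (f e u) > 0"
proof -
  obtain B where B: "B > 0" "\<forall>\<^sub>F \<eta> in at_right 0. near_const_within I R \<eta> B c f"
    using near_const_eventually[OF assms(1,2)] .
  have "\<forall>\<^sub>F \<eta> in at_right 0. \<eta> < Re c / B"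
    unfolding eventually_at_right_field
    by (rule exI[of _ "Re c / B"]) (use B(1) assms(3) in simp)
  with B(2) show ?thesis
  proof eventually_elim
    case (elim \<eta>)
    have "Re (f e u) > 0" if "norm e < \<eta>" "u \<in> polydisc I R" for e u
    proof -
      have "norm (f e u - c) \<le> B * norm e"
        using near_const_withinD(1)[OF elim(1) that] .
      also have "\<dots> < Re c"
        using less_trans[OF that(1) elim(2)] B(1) by (simp add: field_simps)
      finally show ?thesis
        using abs_Re_le_cmod[of "f e u - c"] by simp
    qed
    then show ?case
      by blast
  qed
qed

lemma near_const_local:
  assumes "near_const I c f" "R > 0"
  shows "\<forall>\<^sub>F \<eta> in at_right 0. \<forall>e u v. norm e < \<eta> \<longrightarrow> u \<in> polydisc I R \<longrightarrow> v \<in> polydisc I R \<longrightarrow>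
    (\<forall>i\<in>I. u i = v i) \<longrightarrow> f e u = f e v"
proof -
  obtain B where "\<forall>\<^sub>F \<eta> in at_right 0. near_const_within I R \<eta> B c f"
    using near_const_eventually[OF assms] .
  then show ?thesis
  proof eventually_elim
    case (elim \<eta>)
    show ?case
    proof (intro allI impI)
      fix e :: complex and u v
      assume "norm e < \<eta>" "u \<in> polydisc I R" "v \<in> polydisc I R" "\<forall>i\<in>I. u i = v i"
      then have "norm (f e u - f e v) \<le> B * norm e * 0"
        by (intro near_const_withinD(2)[OF elim]) auto
      then show "f e u = f e v"
        by simp
    qed
  qed
qed

lemma near_const_holomorphic:
  assumes "near_const I c f" "R > 0"
  shows "\<forall>\<^sub>F \<eta> in at_right 0. \<forall>U. (\<forall>i\<in>I. U i holomorphic_on ball 0 \<eta>) \<longrightarrow>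
    (\<forall>e\<in>ball 0 \<eta>. (\<lambda>i. U i e) \<in> polydisc I R) \<longrightarrow> (\<lambda>e. f e (\<lambda>i. U i e)) holomorphic_on ball 0 \<eta>"
proof -
  obtain B where "\<forall>\<^sub>F \<eta> in at_right 0. near_const_within I R \<eta> B c f"
    using near_const_eventually[OF assms] .
  then show ?thesis
  proof eventually_elim
    case (elim \<eta>)
    show ?case
      by (intro allI impI near_const_withinD(3)[OF elim]) auto
  qed
qed

text \<open>Picard iteration from 0 is run for all \<open>e\<close> of a small disc at once. There
  the map halves distances, so the holomorphic iterates converge uniformly and the limit is
  holomorphic; it is real for real \<open>e\<close> because the reals are closed.\<close>

theorem holomorphic_fixed_point:
  fixes F :: "'i \<Rightarrow> complex \<Rightarrow> ('i \<Rightarrow> complex) \<Rightarrow> complex"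
  assumes "finite I" and F: "\<And>i. i \<in> I \<Longrightarrow> near_const I (c i) (F i)"
    and c: "\<And>i. i \<in> I \<Longrightarrow> norm (c i) < R" and "R > 0"
    and "\<delta>0 > 0"
    and real: "\<And>e u i. norm e < \<delta>0 \<Longrightarrow> e \<in> \<real> \<Longrightarrow> u \<in> polydisc I R \<Longrightarrow> (\<And>j. j \<in> I \<Longrightarrow> u j \<in> \<real>) \<Longrightarrow>
      i \<in> I \<Longrightarrow> F i e u \<in> \<real>"
  shows "\<exists>\<delta>>0. \<exists>U. (\<forall>i\<in>I. U i holomorphic_on ball 0 \<delta>) \<and>
    (\<forall>e. norm e < \<delta> \<longrightarrow> (\<lambda>i. U i e) \<in> polydisc I R \<and> (\<forall>i\<in>I. U i e = F i e (\<lambda>i. U i e)) \<and>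
      (e \<in> \<real> \<longrightarrow> (\<forall>i\<in>I. U i e \<in> \<real>)) \<and>
      (\<forall>v\<in>polydisc I R. (\<forall>i\<in>I. v i = F i e v) \<longrightarrow> (\<forall>i\<in>I. v i = U i e)))"
proof -
  have "\<forall>i\<in>I. \<exists>d B. d > 0 \<and> B > 0 \<and> near_const_within I R d B (c i) (F i)"
    using F \<open>R > 0\<close> unfolding near_const_def by blast
  then obtain d B where dB: "\<And>i. i \<in> I \<Longrightarrow> d i > 0" "\<And>i. i \<in> I \<Longrightarrow> B i > 0"
      "\<And>i. i \<in> I \<Longrightarrow> near_const_within I R (d i) (B i) (c i) (F i)"
    by metis
  \<comment> \<open>The bounds secure, in this order, the reality hypothesis, the domain of the
    estimates, the contraction factor 1/2 and the invariance of the polydisc.\<close>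
  define \<delta> where "\<delta> = Min (insert \<delta>0 ((\<lambda>i. Min {d i, 1 / (2 * B i), (R - norm (c i)) / B i}) ` I))"
  have "\<delta> > 0"
    using \<open>finite I\<close> \<open>\<delta>0 > 0\<close> dB c by (auto simp: \<delta>_def)
  have \<delta>: "\<delta> \<le> \<delta>0" "\<And>i. i \<in> I \<Longrightarrow> \<delta> \<le> d i" "\<And>i. i \<in> I \<Longrightarrow> \<delta> \<le> 1 / (2 * B i)"
    "\<And>i. i \<in> I \<Longrightarrow> \<delta> \<le> (R - norm (c i)) / B i"
  proof -
    fix i assume "i \<in> I"
    then have "\<delta> \<le> Min {d i, 1 / (2 * B i), (R - norm (c i)) / B i}"
      unfolding \<delta>_def using \<open>finite I\<close> by (intro Min_le) auto
    then show "\<delta> \<le> d i" "\<delta> \<le> 1 / (2 * B i)" "\<delta> \<le> (R - norm (c i)) / B i"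
      by auto
  qed (use \<open>finite I\<close> in \<open>auto simp: \<delta>_def\<close>)
  have F_within: "near_const_within I R \<delta> (B i) (c i) (F i)" if "i \<in> I" for i
    using near_const_within_mono[OF dB(3)[OF that] \<delta>(2)[OF that]] by simp
  have F_box: "norm (F i e u) \<le> R" if "i \<in> I" "norm e < \<delta>" "u \<in> polydisc I R" for i e u
  proof -
    have "norm (F i e u - c i) \<le> B i * norm e"
      using F_within[OF that(1)] that unfolding near_const_within_def by auto
    also have "\<dots> \<le> B i * ((R - norm (c i)) / B i)"
      using that \<delta>(4)[OF that(1)] dB(2)[OF that(1)] by (intro mult_left_mono) auto
    also have "\<dots> = R - norm (c i)"
      using dB(2)[OF that(1)] by simp
    finally show ?thesis
      using norm_triangle_sub[of "F i e u" "c i"] by simp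
  qed
  have F_contr: "norm (F i e u - F i e v) \<le> D / 2"
    if "i \<in> I" "norm e < \<delta>" "u \<in> polydisc I R" "v \<in> polydisc I R" "D \<ge> 0"
      "\<And>j. j \<in> I \<Longrightarrow> norm (u j - v j) \<le> D" for i e u v D
  proof -
    have "norm (F i e u - F i e v) \<le> B i * norm e * D"
      using F_within[OF that(1)] that unfolding near_const_within_def by auto
    also have "\<dots> \<le> B i * (1 / (2 * B i)) * D"
      using that \<delta>(3)[OF that(1)] dB(2)[OF that(1)]
      by (intro mult_right_mono mult_left_mono) auto
    also have "\<dots> = D / 2"
      using dB(2)[OF that(1)] by simp
    finally show ?thesis .
  qed
  define g where "g = rec_nat (\<lambda>i e. 0) (\<lambda>_ h i e. F i e (\<lambda>j. h j e))"
  have g_0: "g 0 i e = 0" and g_Suc: "g (Suc k) i e = F i e (\<lambda>j. g k j e)" for k i e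
    by (simp_all add: g_def)
  have g_box: "(\<lambda>i. g k i e) \<in> polydisc I R" if "norm e < \<delta>" for k e
    using that \<open>R > 0\<close> by (induction k) (auto simp: g_0 g_Suc polydisc_def intro!: F_box)
  have g_holo: "i \<in> I \<Longrightarrow> g k i holomorphic_on ball 0 \<delta>" for k i
  proof (induction k arbitrary: i)
    case (Suc k)
    have "(\<lambda>e. F i e (\<lambda>j. g k j e)) holomorphic_on ball 0 \<delta>"
      using F_within[OF Suc.prems] Suc.IH g_box unfolding near_const_within_def by auto
    then show ?case
      by (simp add: g_Suc[abs_def])
  qed (simp add: g_0[abs_def])
  have g_step: "i \<in> I \<Longrightarrow> norm (g (Suc k) i e - g k i e) \<le> R * (1 / 2) ^ k" if "norm e < \<delta>" for k i e
  proof (induction k arbitrary: i)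
    case 0
    then show ?case
      using g_box[OF that, of 1] by (auto simp: g_0 polydisc_def)
  next
    case (Suc k)
    have "norm (F i e (\<lambda>j. g (Suc k) j e) - F i e (\<lambda>j. g k j e)) \<le> R * (1 / 2) ^ k / 2"
      using Suc that g_box \<open>R > 0\<close> by (intro F_contr) auto
    then show ?case
      by (simp add: g_Suc)
  qed
  have summable: "summable (\<lambda>k. R * (1 / 2 :: real) ^ k)"
    by (intro summable_mult summable_geometric) auto
  \<comment> \<open>Written as a telescoping series, the limit falls under the Weierstrass test with
    the geometric bound \<open>g_step\<close>.\<close>
  define U where "U = (\<lambda>i e. \<Sum>k. g (Suc k) i e - g k i e)"
  have lim: "uniform_limit (ball 0 \<delta>) (\<lambda>k. g k i) (U i) sequentially" if "i \<in> I" for i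
  proof -
    have "uniform_limit (ball 0 \<delta>) (\<lambda>n e. \<Sum>k<n. g (Suc k) i e - g k i e)
        (\<lambda>e. \<Sum>k. g (Suc k) i e - g k i e) sequentially"
      using g_step that summable by (intro Weierstrass_m_test) auto
    moreover have "(\<Sum>k<n. g (Suc k) i e - g k i e) = g n i e" for n e
      using sum_lessThan_telescope[of "\<lambda>k. g k i e" n] by (simp add: g_0)
    ultimately show ?thesis
      by (simp add: U_def)
  qed
  then have tends: "(\<lambda>k. g k i e) \<longlonglongrightarrow> U i e" if "i \<in> I" "norm e < \<delta>" for i e
    using that by (intro tendsto_uniform_limitI[OF lim]) auto
  have U_box: "(\<lambda>i. U i e) \<in> polydisc I R" if "norm e < \<delta>" for e
    unfolding polydisc_def
  proof safe
    fix i assume "i \<in> I"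
    then show "norm (U i e) \<le> R"
      using g_box[OF that] tendsto_norm[OF tends[OF \<open>i \<in> I\<close> that]]
      by (intro tendsto_upperbound[of "\<lambda>k. norm (g k i e)" _ sequentially])
         (auto simp: polydisc_def)
  qed
  \<comment> \<open>Uniqueness: every fixed point in the polydisc is the limit of these same
    iterates.\<close>
  have attract: "i \<in> I \<Longrightarrow> norm (g k i e - v i) \<le> 2 * R * (1 / 2) ^ k"
    if "norm e < \<delta>" "v \<in> polydisc I R" "\<And>j. j \<in> I \<Longrightarrow> v j = F j e v" for k i e v
  proof (induction k arbitrary: i)
    case 0
    then show ?case
      using that(2) \<open>R > 0\<close> by (force simp: g_0 polydisc_def)
  next
    case (Suc k)
    have "norm (F i e (\<lambda>j. g k j e) - F i e v) \<le> 2 * R * (1 / 2) ^ k / 2"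
      using Suc that g_box \<open>R > 0\<close> by (intro F_contr) auto
    then show ?case
      using that(3)[OF Suc.prems] by (simp add: g_Suc)
  qed
  show ?thesis
  proof (intro exI[of _ \<delta>] exI[of _ U] conjI ballI allI impI)
    show "\<delta> > 0"
      by fact
    show "U i holomorphic_on ball 0 \<delta>" if "i \<in> I" for i
    proof (rule holomorphic_uniform_sequence[OF _ g_holo[OF that]])
      fix x :: complex assume "x \<in> ball 0 \<delta>"
      then obtain r where "r > 0" "cball x r \<subseteq> ball 0 \<delta>"
        using open_contains_cball open_ball by blast
      then show "\<exists>r>0. cball x r \<subseteq> ball 0 \<delta> \<and> uniform_limit (cball x r) (\<lambda>k. g k i) (U i) sequentially"
        using uniform_limit_on_subset[OF lim[OF that]] by blast
    qed simp
    show "(\<lambda>i. U i e) \<in> polydisc I R" if "norm e < \<delta>" for e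
      by (rule U_box[OF that])
    show "U i e = F i e (\<lambda>i. U i e)" if "norm e < \<delta>" "i \<in> I" for e i
    proof -
      have "(\<lambda>k. F i e (\<lambda>j. g k j e)) \<longlonglongrightarrow> F i e (\<lambda>j. U j e)"
      proof (rule Lim_null[THEN iffD2], rule Lim_null_comparison)
        show "\<forall>\<^sub>F k in sequentially. norm (F i e (\<lambda>j. g k j e) - F i e (\<lambda>j. U j e))
          \<le> (\<Sum>j\<in>I. norm (g k j e - U j e)) / 2"
          using that g_box U_box \<open>finite I\<close>
          by (intro always_eventually allI F_contr) (auto intro: sum_nonneg member_le_sum)
        have "(\<lambda>k. (\<Sum>j\<in>I. norm (g k j e - U j e)) / 2) \<longlonglongrightarrow> (\<Sum>j\<in>I. norm (U j e - U j e)) / 2"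
          using tends that by (intro tendsto_intros) auto
        then show "(\<lambda>k. (\<Sum>j\<in>I. norm (g k j e - U j e)) / 2) \<longlonglongrightarrow> 0"
          by simp
      qed
      moreover have "(\<lambda>k. F i e (\<lambda>j. g k j e)) \<longlonglongrightarrow> U i e"
        using LIMSEQ_Suc[OF tends[OF that(2,1)]] by (simp add: g_Suc)
      ultimately show ?thesis
        using LIMSEQ_unique by blast
    qed
    show "U i e \<in> \<real>" if "norm e < \<delta>" "e \<in> \<real>" "i \<in> I" for e i
    proof -
      have "i \<in> I \<Longrightarrow> g k i e \<in> \<real>" for k i
        using that \<delta>(1) g_box by (induction k arbitrary: i) (auto simp: g_0 g_Suc intro!: real)
      then show ?thesis
        using that by (intro Lim_in_closed_set[OF closed_complex_Reals _ _ tends]) auto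
    qed
    show "v i = U i e" if "norm e < \<delta>" "v \<in> polydisc I R" "\<forall>j\<in>I. v j = F j e v" "i \<in> I" for e v i
    proof (rule LIMSEQ_unique[OF _ tends[OF that(4,1)]])
      show "(\<lambda>k. g k i e) \<longlonglongrightarrow> v i"
      proof (rule Lim_null[THEN iffD2], rule Lim_null_comparison)
        show "\<forall>\<^sub>F k in sequentially. norm (g k i e - v i) \<le> 2 * R * (1 / 2) ^ k"
          using attract[OF that(1,2)] that(3,4) by simp
        show "(\<lambda>k. 2 * R * (1 / 2 :: real) ^ k) \<longlonglongrightarrow> 0"
          by (intro tendsto_mult_right_zero LIMSEQ_power_zero) auto
      qed
    qed
  qed
qed

section \<open>The fixed point system of a branch\<close>

text \<open>For a solution \<open>w\<close>, \<open>Amp n\<close> stands for \<open>E - |w\<^sub>n|\<^sup>2\<close> if \<open>n \<le> M\<close> and for \<open>E |w\<^sub>n|\<^sup>2\<close> if \<open>n > M\<close>, and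
  \<open>RatRe n\<close>, \<open>RatIm n\<close> for the real and imaginary part of \<open>E w\<^sub>n / w\<^sub>n\<^sub>-\<^sub>1\<close>, \<open>n > M\<close>. The real and
  imaginary parts are separate unknowns because \<open>e\<close> ranges over a complex disc.\<close>

datatype unknown = Amp nat | RatRe nat | RatIm nat

definition site_sign :: "nat set \<Rightarrow> nat \<Rightarrow> real" where
  "site_sign T n = (if n \<in> T then 1 else - 1)"

locale branch =
  fixes \<gamma> :: "nat \<Rightarrow> real" and N M :: nat and T :: "nat set"
  assumes M_pos: "1 \<le> M" and M_le_N: "M \<le> N" and adm: "admissible \<gamma> M"
begin

text \<open>The ratio index runs to \<open>N + 1\<close>, so \<open>RatRe (M+1)\<close> and
  \<open>RatIm (M+1)\<close> exist even for \<open>M = N\<close>. At \<open>N + 1\<close> the ratio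
  is 0, which encodes \<open>w (N + 1) = 0\<close>.\<close>

definition I :: "unknown set" where
  "I = Amp ` {1..N} \<union> RatRe ` {M+1..N+1} \<union> RatIm ` {M+1..N+1}"

abbreviation \<sigma> :: "nat \<Rightarrow> real" where
  "\<sigma> \<equiv> site_sign T"

definition flux :: "nat \<Rightarrow> real" where
  "flux n = (\<Sum>k=n..M. \<gamma> k)"

text \<open>With \<open>e = 1/E\<close>: \<open>S\<close> is \<open>|w\<^sub>n|\<^sup>2 / E\<close>, with \<open>|w\<^sub>0| = |w\<^sub>1|\<close> built in; \<open>X\<close>, \<open>Y\<close> are real and imaginary
  part of \<open>w\<^sub>n cnj w\<^sub>n\<^sub>-\<^sub>1 / E\<close> for \<open>n \<le> M + 1\<close>, where \<open>Y\<close> is the summed flux balance and \<open>X\<close> follows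
  from \<open>X\<^sup>2 + Y\<^sup>2 = S\<^sub>n\<^sub>-\<^sub>1 S\<^sub>n\<close>; \<open>p - \<i> q\<close> is \<open>w\<^sub>n\<^sub>-\<^sub>1 / (E w\<^sub>n)\<close> for \<open>n > M\<close>; and \<open>r\<close> is \<open>w\<^sub>n / w\<^sub>n\<^sub>-\<^sub>1\<close>.\<close>

definition S :: "complex \<Rightarrow> (unknown \<Rightarrow> complex) \<Rightarrow> nat \<Rightarrow> complex" where
  "S e u n = (if n \<le> M then 1 - e * u (Amp (max 1 n)) else e * (e * u (Amp n)))"

definition Y :: "complex \<Rightarrow> (unknown \<Rightarrow> complex) \<Rightarrow> nat \<Rightarrow> complex" where
  "Y e u n = (\<Sum>k=n..M. of_real (\<gamma> k) * S e u k) + e * u (RatIm (M+1)) * S e u M"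

definition P :: "complex \<Rightarrow> (unknown \<Rightarrow> complex) \<Rightarrow> nat \<Rightarrow> complex" where
  "P e u n = S e u (n - 1) * S e u n - (Y e u n)\<^sup>2"

definition X :: "complex \<Rightarrow> (unknown \<Rightarrow> complex) \<Rightarrow> nat \<Rightarrow> complex" where
  "X e u n = (if n \<le> M then of_real (\<sigma> n) * csqrt (P e u n) else e * u (RatRe (M+1)) * S e u M)"

definition p :: "complex \<Rightarrow> (unknown \<Rightarrow> complex) \<Rightarrow> nat \<Rightarrow> complex" where
  "p e u n = 1 - e * (e * u (Amp n)) - e * (e * u (RatRe (n+1)))"

definition q :: "complex \<Rightarrow> (unknown \<Rightarrow> complex) \<Rightarrow> nat \<Rightarrow> complex" where
  "q e u n = e * of_real (\<gamma> n) + e * (e * u (RatIm (n+1)))"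

text \<open>For a solution this is \<open>(|w (n-1)| / (E |w n|))\<^sup>2\<close>, written without
  conjugation so that it is holomorphic.\<close>

definition D :: "complex \<Rightarrow> (unknown \<Rightarrow> complex) \<Rightarrow> nat \<Rightarrow> complex" where
  "D e u n = (p e u n)\<^sup>2 + (q e u n)\<^sup>2"

text \<open>For \<open>n \<le> M\<close>, \<open>Amp n\<close> comes from the real part of the
  equation times \<open>cnj (w n)\<close>. In the tail the equation is divided by
  \<open>E * w n\<close> and inverted: \<open>E * w n / w (n-1)\<close> is
  \<open>1 / (p - \<i> * q) = (p + \<i> * q) / D\<close>.\<close>

primrec F :: "unknown \<Rightarrow> complex \<Rightarrow> (unknown \<Rightarrow> complex) \<Rightarrow> complex" where
  "F (Amp n) e u = (if n \<le> M then (X e u n + X e u (n+1)) / S e u n else S e u (n-1) / D e u n)"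
| "F (RatRe n) e u = (if n \<le> N then p e u n / D e u n else 0)"
| "F (RatIm n) e u = (if n \<le> N then q e u n / D e u n else 0)"

definition r :: "complex \<Rightarrow> (unknown \<Rightarrow> complex) \<Rightarrow> nat \<Rightarrow> complex" where
  "r e u n = (if n \<le> M then (X e u n + \<i> * Y e u n) / S e u (n-1)
     else e * u (RatRe n) + \<i> * (e * u (RatIm n)))"

text \<open>The boundary condition \<open>w\<^sub>0 = cnj w\<^sub>1\<close> turns \<open>r 1\<close> into \<open>w\<^sub>1\<^sup>2 / |w\<^sub>1|\<^sup>2\<close>, so \<open>w\<^sub>1\<close> is a square root of
  \<open>E (X + \<i> Y)\<close>. Pulling out the sign \<open>\<sigma> 1\<close> keeps the argument of \<open>csqrt\<close> in the right half plane, away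
  from the branch cut.\<close>

definition V :: "complex \<Rightarrow> (unknown \<Rightarrow> complex) \<Rightarrow> nat \<Rightarrow> complex" where
  "V e u n = csqrt (of_real (\<sigma> 1)) * csqrt (of_real (\<sigma> 1) * (X e u 1 + \<i> * Y e u 1)) *
     (\<Prod>k=2..n. r e u k)"

text \<open>\<open>V\<close> is the solution divided by \<open>sqrt E\<close>, which has a limit as
  \<open>e\<close> tends to 0; the factor that is singular there is restored only here.\<close>

definition W :: "real \<Rightarrow> (unknown \<Rightarrow> complex) \<Rightarrow> nat \<Rightarrow> complex" where
  "W E u n = (if n = 0 then cnj (of_real (sqrt E) * V (of_real (1 / E)) u 1)
     else if n \<le> N then of_real (sqrt E) * V (of_real (1 / E)) u n else 0)"

section \<open>Limits at \<open>e = 0\<close> of the functions in the fixed point system\<close>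

lemma finite_I: "finite I"
  by (simp add: I_def)

lemma sign_sq: "\<sigma> n * \<sigma> n = 1" and abs_sign: "\<bar>\<sigma> n\<bar> = 1"
  by (simp_all add: site_sign_def)

lemma Amp_mem: "1 \<le> n \<Longrightarrow> n \<le> N \<Longrightarrow> Amp n \<in> I" and Rat_mem: "M < n \<Longrightarrow> n \<le> N + 1 \<Longrightarrow> RatRe n \<in> I"
  "M < n \<Longrightarrow> n \<le> N + 1 \<Longrightarrow> RatIm n \<in> I"
  by (auto simp: I_def)

lemma abs_flux_less: "1 \<le> n \<Longrightarrow> n \<le> M \<Longrightarrow> \<bar>flux n\<bar> < 1"
  using adm by (simp add: admissible_def flux_def)

lemma flux_sq_less: "1 \<le> n \<Longrightarrow> n \<le> M \<Longrightarrow> (flux n)\<^sup>2 < 1"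
  using abs_flux_less by (simp add: abs_square_less_1)

lemma near_const_S:
  assumes "n \<le> N"
  shows "near_const I (if n \<le> M then 1 else 0) (\<lambda>e u. S e u n)"
proof (cases "n \<le> M")
  case True
  have "near_const I (1 - 0) (\<lambda>e u. 1 - e * u (Amp (max 1 n)))"
    using assms M_pos M_le_N by (intro near_const_intros Amp_mem) auto
  then show ?thesis
    using True by (simp add: S_def)
next
  case False
  have "near_const I (0 * 0) (\<lambda>e u. e * (e * u (Amp n)))"
    using assms M_pos False by (intro near_const_intros Amp_mem) auto
  then show ?thesis
    using False by (simp add: S_def)
qed

lemma near_const_S_large: "n \<le> M \<Longrightarrow> near_const I 1 (\<lambda>e u. S e u n)"
  using near_const_S[of n] M_le_N by simp

lemma near_const_Y: "near_const I (of_real (flux n)) (\<lambda>e u. Y e u n)"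
proof -
  have "near_const I (of_real (\<gamma> k) * 1) (\<lambda>e u. of_real (\<gamma> k) * S e u k)" if "k \<le> M" for k
    using near_const_S[of k] that M_le_N by (intro near_const_mult near_const_const) auto
  moreover have "near_const I (0 * 1) (\<lambda>e u. e * u (RatIm (M+1)) * S e u M)"
    using M_le_N by (intro near_const_mult near_const_e_mult_var near_const_S_large Rat_mem) auto
  ultimately have "near_const I ((\<Sum>k=n..M. of_real (\<gamma> k) * 1) + 0 * 1) (\<lambda>e u. Y e u n)"
    unfolding Y_def by (intro near_const_add near_const_sum) auto
  then show ?thesis
    by (simp add: flux_def)
qed

lemma near_const_P:
  assumes "1 \<le> n" "n \<le> M"
  shows "near_const I (of_real (1 - (flux n)\<^sup>2)) (\<lambda>e u. P e u n)"
proof -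
  have "near_const I (1 * 1 - (of_real (flux n))\<^sup>2) (\<lambda>e u. P e u n)"
    unfolding P_def using assms
    by (intro near_const_diff near_const_mult near_const_power2 near_const_S_large near_const_Y) auto
  then show ?thesis
    by simp
qed

definition X0 :: "nat \<Rightarrow> real" where
  "X0 n = (if n \<le> M then \<sigma> n * sqrt (1 - (flux n)\<^sup>2) else 0)"

lemma abs_X0_le: "1 \<le> n \<Longrightarrow> \<bar>X0 n\<bar> \<le> 1"
  using flux_sq_less[of n] by (auto simp: X0_def abs_mult abs_sign)

lemma near_const_X:
  assumes "1 \<le> n"
  shows "near_const I (of_real (X0 n)) (\<lambda>e u. X e u n)"
proof (cases "n \<le> M")
  case True
  have "near_const I (of_real (\<sigma> n) * csqrt (of_real (1 - (flux n)\<^sup>2)))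
      (\<lambda>e u. of_real (\<sigma> n) * csqrt (P e u n))"
    using near_const_P[OF assms True] flux_sq_less[OF assms True]
    by (intro near_const_cmult near_const_csqrt) auto
  moreover have "csqrt (of_real (1 - (flux n)\<^sup>2)) = of_real (sqrt (1 - (flux n)\<^sup>2))"
    using flux_sq_less[OF assms True] by (intro csqrt_of_real) simp
  ultimately show ?thesis
    using True by (simp add: X_def X0_def)
next
  case False
  have "near_const I (0 * 1) (\<lambda>e u. e * u (RatRe (M+1)) * S e u M)"
    using M_le_N by (intro near_const_mult near_const_e_mult_var near_const_S_large Rat_mem) auto
  then show ?thesis
    using False by (simp add: X_def X0_def)
qed

lemma near_const_p_q_D:
  assumes "M < n" "n \<le> N"
  shows near_const_p: "near_const I 1 (\<lambda>e u. p e u n)"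
    and near_const_q: "near_const I 0 (\<lambda>e u. q e u n)"
    and near_const_D: "near_const I 1 (\<lambda>e u. D e u n)"
proof -
  have "near_const I (1 - 0 * 0 - 0 * 0) (\<lambda>e u. p e u n)"
    unfolding p_def using assms by (intro near_const_intros Amp_mem Rat_mem) auto
  then show p: "near_const I 1 (\<lambda>e u. p e u n)"
    by simp
  have "near_const I (0 * of_real (\<gamma> n) + 0 * 0) (\<lambda>e u. q e u n)"
    unfolding q_def using assms by (intro near_const_intros Rat_mem) auto
  then show q: "near_const I 0 (\<lambda>e u. q e u n)"
    by simp
  show "near_const I 1 (\<lambda>e u. D e u n)"
    using near_const_add[OF near_const_power2[OF p] near_const_power2[OF q]] by (simp add: D_def)
qed

text \<open>The limits are \<open>X0 n + X0 (n + 1)\<close>, 0 or 1. The bound 2 lies strictly below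
  the radius 32 used later, so that polydisc is invariant for small \<open>e\<close>.\<close>

lemma near_const_F:
  assumes "i \<in> I"
  obtains c where "norm c \<le> 2" "near_const I c (F i)"
proof -
  have "\<exists>c. norm c \<le> 2 \<and> near_const I c (\<lambda>e u. F i e u)"
  proof (cases i)
    case (Amp n)
    then have n: "1 \<le> n" "n \<le> N"
      using assms by (auto simp: I_def)
    show ?thesis
    proof (cases "n \<le> M")
      case True
      have "near_const I ((of_real (X0 n) + of_real (X0 (n + 1))) / 1)
          (\<lambda>e u. (X e u n + X e u (n+1)) / S e u n)"
        using near_const_S[of n] n True by (intro near_const_intros near_const_X) auto
      moreover have "norm (of_real (X0 n) + of_real (X0 (n + 1)) :: complex) \<le> 2"
        using abs_X0_le[of n] abs_X0_le[of "n+1"] n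
        by (intro order.trans[OF norm_triangle_ineq]) auto
      ultimately show ?thesis
        using Amp True by auto
    next
      case False
      have "near_const I ((if n - 1 \<le> M then 1 else 0) / 1) (\<lambda>e u. S e u (n-1) / D e u n)"
        using near_const_S[of "n - 1"] near_const_D[of n] n False
        by (intro near_const_divide) auto
      then show ?thesis
        using Amp False by (intro exI[of _ "if n - 1 \<le> M then 1 else 0"]) auto
    qed
  next
    case (RatRe n)
    then have n: "M < n" "n \<le> N + 1"
      using assms by (auto simp: I_def)
    show ?thesis
    proof (cases "n \<le> N")
      case True
      have "near_const I (1 / 1) (\<lambda>e u. p e u n / D e u n)"
        using near_const_p_q_D[OF n(1) True] by (intro near_const_divide) auto
      then show ?thesis
        using RatRe True by (intro exI[of _ 1]) auto
    next
      case False
      then show ?thesis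
        using RatRe near_const_const by (intro exI[of _ 0]) auto
    qed
  next
    case (RatIm n)
    then have n: "M < n" "n \<le> N + 1"
      using assms by (auto simp: I_def)
    show ?thesis
    proof (cases "n \<le> N")
      case True
      have "near_const I (0 / 1) (\<lambda>e u. q e u n / D e u n)"
        using near_const_p_q_D[OF n(1) True] by (intro near_const_divide) auto
      then show ?thesis
        using RatIm True by (intro exI[of _ 0]) auto
    next
      case False
      then show ?thesis
        using RatIm near_const_const by (intro exI[of _ 0]) auto
    qed
  qed
  then show ?thesis
    using that by blast
qed

lemma near_const_r:
  assumes "1 \<le> n" "n \<le> N"
  obtains c where "near_const I c (\<lambda>e u. r e u n)"
proof (cases "n \<le> M")
  case True
  have "near_const I ((of_real (X0 n) + \<i> * of_real (flux n)) / 1) (\<lambda>e u. r e u n)"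
    unfolding r_def if_P[OF True] using True assms
    by (intro near_const_divide near_const_add near_const_cmult near_const_S_large near_const_X
        near_const_Y) auto
  then show ?thesis
    by (rule that)
next
  case False
  have "near_const I (0 + \<i> * 0) (\<lambda>e u. r e u n)"
    unfolding r_def if_not_P[OF False] using assms False
    by (intro near_const_intros near_const_cmult Rat_mem) auto
  then show ?thesis
    by (rule that)
qed

lemma near_const_V:
  assumes "n \<le> N"
  obtains c where "near_const I c (\<lambda>e u. V e u n)"
proof -
  have "\<forall>k\<in>{2..n}. \<exists>c. near_const I c (\<lambda>e u. r e u k)"
    using near_const_r assms by (metis atLeastAtMost_iff one_le_numeral order.trans)
  then obtain c where "\<And>k. k \<in> {2..n} \<Longrightarrow> near_const I (c k) (\<lambda>e u. r e u k)"
    by metis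
  moreover have "near_const I (csqrt (of_real (\<sigma> 1) * (of_real (X0 1) + \<i> * of_real (flux 1))))
      (\<lambda>e u. csqrt (of_real (\<sigma> 1) * (X e u 1 + \<i> * Y e u 1)))"
  proof (rule near_const_csqrt)
    show "near_const I (of_real (\<sigma> 1) * (of_real (X0 1) + \<i> * of_real (flux 1)))
      (\<lambda>e u. of_real (\<sigma> 1) * (X e u 1 + \<i> * Y e u 1))"
      using near_const_X[of 1] near_const_Y[of 1]
      by (intro near_const_cmult near_const_add) auto
    \<comment> \<open>Since the sign squares to 1, the real part is
      \<open>sqrt (1 - (flux 1)\<^sup>2)\<close>.\<close>
    show "0 < Re (of_real (\<sigma> 1) * (of_real (X0 1) + \<i> * of_real (flux 1)))"
      using flux_sq_less[of 1] M_pos sign_sq[of 1] by (simp add: X0_def flip: mult.assoc)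
  qed
  ultimately have "near_const I (csqrt (of_real (\<sigma> 1)) *
      csqrt (of_real (\<sigma> 1) * (of_real (X0 1) + \<i> * of_real (flux 1))) * (\<Prod>k=2..n. c k)) (\<lambda>e u. V e u n)"
    unfolding V_def by (intro near_const_mult near_const_const near_const_prod) auto
  then show ?thesis
    by (rule that)
qed

text \<open>This makes the divisions and square roots legitimate. \<open>S\<close> at tail sites is
  left out because it tends to 0; \<open>S_nz\<close> obtains its nonvanishing recursively at fixed
  points.\<close>

definition good :: "complex \<Rightarrow> (unknown \<Rightarrow> complex) \<Rightarrow> bool" where
  "good e u \<longleftrightarrow> (\<forall>n\<in>{..M}. Re (S e u n) > 0) \<and> (\<forall>n\<in>{1..M}. Re (P e u n) > 0) \<and>
     (\<forall>n\<in>{M+1..N}. Re (D e u n) > 0)"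

lemma eventually_good:
  assumes "R > 0"
  shows "\<forall>\<^sub>F \<eta> in at_right 0. \<forall>e u. norm e < \<eta> \<longrightarrow> u \<in> polydisc I R \<longrightarrow> good e u"
proof -
  let ?ev = "\<lambda>f. \<forall>\<^sub>F \<eta> in at_right 0. \<forall>e u. norm e < \<eta> \<longrightarrow> u \<in> polydisc I R \<longrightarrow> Re (f e u) > 0"
  have "?ev (\<lambda>e u. S e u n)" if "n \<in> {..M}" for n
    using near_const_S_large that assms by (intro near_const_Re_pos) auto
  then have 1: "\<forall>\<^sub>F \<eta> in at_right 0. \<forall>n\<in>{..M}. \<forall>e u. norm e < \<eta> \<longrightarrow> u \<in> polydisc I R \<longrightarrow> Re (S e u n) > 0"
    by (intro eventually_ball_finite) auto
  have "?ev (\<lambda>e u. P e u n)" if "n \<in> {1..M}" for n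
    using near_const_P[of n] flux_sq_less[of n] that assms by (intro near_const_Re_pos) auto
  then have 2: "\<forall>\<^sub>F \<eta> in at_right 0. \<forall>n\<in>{1..M}. \<forall>e u. norm e < \<eta> \<longrightarrow> u \<in> polydisc I R \<longrightarrow> Re (P e u n) > 0"
    by (intro eventually_ball_finite) auto
  have "?ev (\<lambda>e u. D e u n)" if "n \<in> {M+1..N}" for n
    using near_const_D[of n] that assms by (intro near_const_Re_pos) auto
  then have "\<forall>\<^sub>F \<eta> in at_right 0. \<forall>n\<in>{M+1..N}. \<forall>e u. norm e < \<eta> \<longrightarrow> u \<in> polydisc I R \<longrightarrow> Re (D e u n) > 0"
    by (intro eventually_ball_finite) auto
  with 1 2 show ?thesis
    unfolding good_def by eventually_elim blast
qed

section \<open>Real values at real parameters\<close>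

context
  fixes e :: complex and u :: "unknown \<Rightarrow> complex"
  assumes e_real: "e \<in> \<real>" and u_real: "\<And>i. i \<in> I \<Longrightarrow> u i \<in> \<real>" and good: "good e u"
begin

lemma S_real: "n \<le> N \<Longrightarrow> S e u n \<in> \<real>"
  using M_pos M_le_N e_real unfolding S_def by (auto intro!: Reals_mult Reals_diff u_real Amp_mem)

lemma Y_real: "Y e u n \<in> \<real>"
  using M_le_N e_real unfolding Y_def
  by (auto intro!: Reals_add sum_in_Reals Reals_mult S_real u_real Rat_mem)

lemma P_real: "n \<le> M \<Longrightarrow> P e u n \<in> \<real>"
  using M_le_N unfolding P_def by (auto intro!: Reals_diff Reals_mult Reals_power S_real Y_real)

lemma csqrt_P: "1 \<le> n \<Longrightarrow> n \<le> M \<Longrightarrow> csqrt (P e u n) = of_real (sqrt (Re (P e u n)))"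
  using P_real[of n] good
  by (intro csqrt_of_real_nonneg) (auto simp: good_def complex_is_Real_iff less_imp_le)

lemma X_real: "1 \<le> n \<Longrightarrow> X e u n \<in> \<real>"
  using M_le_N e_real csqrt_P unfolding X_def by (auto intro!: Reals_mult S_real u_real Rat_mem)

lemma p_real: "M < n \<Longrightarrow> n \<le> N \<Longrightarrow> p e u n \<in> \<real>"
  using e_real unfolding p_def by (auto intro!: Reals_mult Reals_diff u_real Amp_mem Rat_mem)

lemma q_real: "M < n \<Longrightarrow> n \<le> N \<Longrightarrow> q e u n \<in> \<real>"
  using e_real unfolding q_def by (auto intro!: Reals_mult Reals_add u_real Rat_mem)

lemma F_real:
  assumes "i \<in> I"
  shows "F i e u \<in> \<real>"
proof (cases i)
  case (Amp n)
  then have "1 \<le> n" "n \<le> N"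
    using assms by (auto simp: I_def)
  then show ?thesis
    using Amp p_real q_real
    by (auto simp: D_def intro!: Reals_divide Reals_add Reals_power S_real X_real)
next
  case (RatRe n)
  then show ?thesis
    using assms p_real q_real by (auto simp: D_def I_def intro!: Reals_divide Reals_add Reals_power)
next
  case (RatIm n)
  then show ?thesis
    using assms p_real q_real by (auto simp: D_def I_def intro!: Reals_divide Reals_add Reals_power)
qed

end

end

section \<open>From fixed points to solutions\<close>

context branch
begin

lemma D_factor: "D e u n = (p e u n + \<i> * q e u n) * (p e u n - \<i> * q e u n)"
  by (simp add: D_def power2_eq_square algebra_simps)

context
  fixes E :: real and u :: "unknown \<Rightarrow> complex" and e :: complex
  defines "e \<equiv> of_real (1 / E)"
  assumes E_pos: "E > 0" and u_real: "\<And>i. i \<in> I \<Longrightarrow> u i \<in> \<real>" and good: "good e u"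
    and fixed: "\<And>i. i \<in> I \<Longrightarrow> u i = F i e u"
begin

lemma e_real: "e \<in> \<real>" and e_nz: "e \<noteq> 0" and E_e: "of_real E * e = 1" and E_eq: "of_real E = 1 / e"
  using E_pos by (auto simp: e_def)

lemma cnj_simps: "cnj e = e" "n \<le> N \<Longrightarrow> cnj (S e u n) = S e u n" "cnj (Y e u n) = Y e u n"
  "1 \<le> n \<Longrightarrow> cnj (X e u n) = X e u n" "i \<in> I \<Longrightarrow> cnj (u i) = u i"
  using e_real S_real[OF e_real u_real good] Y_real[OF e_real u_real good]
    X_real[OF e_real u_real good] u_real by (auto simp: Reals_cnj_iff)

lemma S_large_nz: "n \<le> M \<Longrightarrow> S e u n \<noteq> 0"
  using good unfolding good_def by (metis atMost_iff less_irrefl zero_complex.simps(1))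

lemma D_nz:
  assumes "M < n" "n \<le> N"
  shows "D e u n \<noteq> 0"
proof -
  have "Re (D e u n) > 0"
    using good assms by (simp add: good_def)
  then show ?thesis
    by auto
qed

lemma XY_sq:
  assumes "1 \<le> n" "n \<le> M"
  shows "(X e u n + \<i> * Y e u n) * (X e u n - \<i> * Y e u n) = S e u (n - 1) * S e u n"
proof -
  have "(X e u n)\<^sup>2 = of_real (\<sigma> n * \<sigma> n) * P e u n"
    using assms by (simp add: X_def power_mult_distrib power2_eq_square[of "complex_of_real _"])
  then have "(X e u n)\<^sup>2 + (Y e u n)\<^sup>2 = S e u (n - 1) * S e u n"
    by (simp add: sign_sq P_def)
  moreover have "(x + \<i> * y) * (x - \<i> * y) = x\<^sup>2 + y\<^sup>2" for x y :: complex
    by (simp add: power2_eq_square algebra_simps)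
  ultimately show ?thesis
    by simp
qed

lemma r_small:
  assumes "M < n" "n \<le> N"
  shows "r e u n = e * (p e u n + \<i> * q e u n) / D e u n"
    and "cnj (r e u n) = e * (p e u n - \<i> * q e u n) / D e u n"
proof -
  have u: "u (RatRe n) = p e u n / D e u n" "u (RatIm n) = q e u n / D e u n"
    using fixed[OF Rat_mem(1), of n] fixed[OF Rat_mem(2), of n] assms by simp_all
  have "r e u n = e * (u (RatRe n) + \<i> * u (RatIm n))"
    using assms by (simp add: r_def algebra_simps)
  then show "r e u n = e * (p e u n + \<i> * q e u n) / D e u n"
    unfolding u by (simp add: add_divide_distrib algebra_simps)
  have "cnj (r e u n) = e * (u (RatRe n) - \<i> * u (RatIm n))"
    using assms by (simp add: r_def cnj_simps(1,5) Rat_mem algebra_simps)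
  then show "cnj (r e u n) = e * (p e u n - \<i> * q e u n) / D e u n"
    unfolding u by (simp add: diff_divide_distrib algebra_simps)
qed

lemma S_small:
  assumes "M < n" "n \<le> N"
  shows "S e u n = e * e * S e u (n - 1) / D e u n"
  using fixed[OF Amp_mem, of n] assms M_pos by (simp add: S_def[of e u n])

lemma S_nz: "n \<le> N \<Longrightarrow> S e u n \<noteq> 0"
proof (induction n)
  case (Suc n)
  show ?case
  proof (cases "Suc n \<le> M")
    case False
    then show ?thesis
      using S_small[of "Suc n"] D_nz[of "Suc n"] Suc e_nz by simp
  qed (use S_large_nz in auto)
qed (use S_large_nz in auto)

lemma cnj_r_large: "1 \<le> n \<Longrightarrow> n \<le> M \<Longrightarrow> cnj (r e u n) = (X e u n - \<i> * Y e u n) / S e u (n - 1)"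
  using M_le_N by (simp add: r_def cnj_simps)

text \<open>Moduli and tail ratios are separate unknowns; the fixed point equations make them
  consistent. Within the block, consistency is built into \<open>X\<close>.\<close>

lemma r_cnj_r:
  assumes "1 \<le> n" "n \<le> N"
  shows "r e u n * cnj (r e u n) * S e u (n - 1) = S e u n"
proof (cases "n \<le> M")
  case True
  then have "r e u n * cnj (r e u n) * S e u (n - 1) =
      (X e u n + \<i> * Y e u n) * (X e u n - \<i> * Y e u n) / S e u (n - 1)"
    using assms S_large_nz[of "n - 1"] cnj_r_large[of n] by (simp add: r_def)
  also have "\<dots> = S e u n"
    using XY_sq[OF assms(1) True] True S_large_nz[of "n - 1"] by simp
  finally show ?thesis .
next
  case False
  then have *: "M < n" by simp
  have "r e u n * cnj (r e u n) = e * e * (D e u n / (D e u n * D e u n))"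
    unfolding r_small(2)[OF * assms(2)] unfolding r_small(1)[OF * assms(2)]
    by (subst (3) D_factor) (simp add: mult_ac)
  then show ?thesis
    using S_small[OF * assms(2)] D_nz[OF * assms(2)] by simp
qed

text \<open>This is the stationary equation divided by \<open>W E u n\<close>; the second summand
  will be \<open>W E u (n - 1) / W E u n\<close>. In the block it combines the telescoping of
  \<open>Y\<close> with the equation for \<open>Amp n\<close>; in the tail it unfolds
  \<open>p\<close> and \<open>q\<close>.\<close>

lemma recurrence:
  assumes "1 \<le> n" "n \<le> N"
  shows "r e u (n + 1) + cnj (r e u n) * S e u (n - 1) / S e u n =
    of_real E - \<i> * of_real (\<gamma> n) - of_real E * S e u n"
proof (cases "n \<le> M")
  case True
  have S: "S e u n \<noteq> 0" "S e u (n - 1) \<noteq> 0"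
    using True S_large_nz by auto
  have "r e u (n + 1) = (X e u (n + 1) + \<i> * Y e u (n + 1)) / S e u n"
  \<comment> \<open>At \<open>n = M\<close> the next ratio belongs to the tail; \<open>X\<close> and
    \<open>Y\<close> at \<open>M + 1\<close> are defined so that the block formula persists.\<close>
  proof (cases "n = M")
    case True
    then show ?thesis
      using S by (simp add: r_def X_def Y_def divide_simps algebra_simps)
  qed (use True in \<open>simp add: r_def\<close>)
  moreover have "cnj (r e u n) * S e u (n - 1) / S e u n = (X e u n - \<i> * Y e u n) / S e u n"
    using cnj_r_large[OF assms(1) True] S by simp
  moreover have "Y e u n = of_real (\<gamma> n) * S e u n + Y e u (n + 1)"
    using True by (simp add: Y_def sum.atLeast_Suc_atMost)
  moreover have "(X e u n + X e u (n + 1)) / S e u n = of_real E - of_real E * S e u n"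
  proof -
    have "(X e u n + X e u (n + 1)) / S e u n = u (Amp n)"
      using fixed[OF Amp_mem, of n] assms True by simp
    also have "\<dots> = (of_real E * e) * u (Amp n)"
      unfolding E_e by simp
    also have "\<dots> = of_real E - of_real E * S e u n"
      using True assms by (simp add: S_def algebra_simps)
    finally show ?thesis .
  qed
  ultimately show ?thesis
    using S by (simp add: divide_simps) (simp add: algebra_simps)
next
  case False
  then have n: "M < n" by simp
  have "S e u n \<noteq> 0" "D e u n \<noteq> 0"
    using S_nz D_nz n assms by auto
  moreover have "S e u n * D e u n = e * e * S e u (n - 1)"
    using S_small[OF n assms(2)] D_nz[OF n assms(2)] by simp
  ultimately have pred: "cnj (r e u n) * S e u (n - 1) / S e u n = (p e u n - \<i> * q e u n) / e"
    unfolding r_small(2)[OF n assms(2)] using e_nz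
    by (simp add: divide_simps) (simp add: algebra_simps)
  have "S e u n = e * (e * u (Amp n))" "r e u (n + 1) = e * u (RatRe (n+1)) + \<i> * (e * u (RatIm (n+1)))"
    using n by (simp_all add: S_def r_def)
  then show ?thesis
    unfolding pred using e_nz by (simp add: E_eq p_def q_def field_simps)
qed

lemma V_1: "(V e u 1)\<^sup>2 = X e u 1 + \<i> * Y e u 1"
  using sign_sq[of 1] by (simp add: V_def power_mult_distrib flip: mult.assoc of_real_mult)

lemma W_pos: "1 \<le> n \<Longrightarrow> n \<le> N \<Longrightarrow> W E u n = of_real (sqrt E) * V e u n"
  by (simp add: W_def e_def)

lemma W_0: "W E u 0 = cnj (W E u 1)"
  using M_pos M_le_N by (simp add: W_def)

lemma W_1_sq: "(W E u 1)\<^sup>2 = of_real E * (X e u 1 + \<i> * Y e u 1)"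
  using W_pos[of 1] M_pos M_le_N V_1 E_pos
  by (simp add: power_mult_distrib flip: of_real_power)

lemma W_Suc:
  assumes "1 \<le> n" "n < N"
  shows "W E u (Suc n) = r e u (Suc n) * W E u n"
  using assms by (simp add: W_pos V_def)

text \<open>At site 1 only the square of \<open>W\<close> is explicit: its squared modulus is
  \<open>E\<^sup>2 * S 0 * S 1\<close> with \<open>S 0 = S 1\<close>, and positivity of
  \<open>S 1\<close> selects the root. The other sites follow by \<open>r_cnj_r\<close>.\<close>

lemma W_cnj_W: "1 \<le> n \<Longrightarrow> n \<le> N \<Longrightarrow> W E u n * cnj (W E u n) = of_real E * S e u n"
proof (induction n rule: nat_induct_at_least)
  case base
  have "(cmod ((W E u 1)\<^sup>2))\<^sup>2 = (E * Re (S e u 1))\<^sup>2"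
  proof -
    have "complex_of_real ((cmod ((W E u 1)\<^sup>2))\<^sup>2) =
        of_real E * (X e u 1 + \<i> * Y e u 1) * (of_real E * (X e u 1 - \<i> * Y e u 1))"
      unfolding complex_norm_square W_1_sq by (simp add: cnj_simps)
    also have "\<dots> = of_real E * of_real E * (S e u 0 * S e u 1)"
      using XY_sq[of 1] M_pos by simp
    also have "S e u 0 = S e u 1"
      using M_pos by (simp add: S_def)
    also have "S e u 1 = of_real (Re (S e u 1))"
      using S_real[OF e_real u_real good, of 1] base by simp
    finally have "complex_of_real ((cmod ((W E u 1)\<^sup>2))\<^sup>2) = of_real ((E * Re (S e u 1))\<^sup>2)"
      by (simp add: power2_eq_square algebra_simps)
    then show ?thesis
      by (simp only: of_real_eq_iff)
  qed
  then have "cmod ((W E u 1)\<^sup>2) = E * Re (S e u 1)"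
    using E_pos good M_pos by (subst (asm) power2_eq_iff_nonneg) (auto simp: good_def less_imp_le)
  then have "W E u 1 * cnj (W E u 1) = of_real (E * Re (S e u 1))"
    unfolding complex_norm_square[symmetric] by (simp add: norm_power)
  then show ?case
    using S_real[OF e_real u_real good, of 1] base by simp
next
  case (Suc n)
  have "W E u (Suc n) * cnj (W E u (Suc n)) =
      r e u (Suc n) * cnj (r e u (Suc n)) * (W E u n * cnj (W E u n))"
    using Suc W_Suc[of n] by simp
  also have "\<dots> = of_real E * (r e u (Suc n) * cnj (r e u (Suc n)) * S e u (Suc n - 1))"
    using Suc by simp
  also have "\<dots> = of_real E * S e u (Suc n)"
    using r_cnj_r[of "Suc n"] Suc.prems by simp
  finally show ?case .
qed

text \<open>The case \<open>n = 1\<close> is the boundary condition: there the factor is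
  \<open>cnj (w 1) / w 1\<close>, by the formula for \<open>(w 1)\<^sup>2\<close>.\<close>

lemma W_pred:
  assumes "1 \<le> n" "n \<le> N"
  shows "W E u (n - 1) = cnj (r e u n) * S e u (n - 1) / S e u n * W E u n"
proof (cases "n = 1")
  case True
  have "S e u 0 = S e u 1" "S e u 1 \<noteq> 0"
    using M_pos M_le_N S_nz[of 1] by (simp_all add: S_def)
  then have "cnj (r e u n) * S e u (n - 1) / S e u n = (X e u 1 - \<i> * Y e u 1) / S e u 1"
    using True cnj_r_large[of 1] M_pos by simp
  also have "\<dots> = cnj ((W E u 1)\<^sup>2) / (of_real E * S e u 1)"
    unfolding W_1_sq using E_pos by (simp add: cnj_simps)
  also have "of_real E * S e u 1 = W E u 1 * cnj (W E u 1)"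
    using W_cnj_W[of 1] assms by simp
  also have "cnj ((W E u 1)\<^sup>2) / (W E u 1 * cnj (W E u 1)) * W E u 1 = cnj (W E u 1)"
    by (simp add: power2_eq_square)
  finally show ?thesis
    using True W_0 by simp
next
  case False
  then obtain m where m: "n = Suc m" "1 \<le> m" "m < N"
    using assms by (cases n) auto
  have "cnj (r e u n) * S e u (n - 1) / S e u n * W E u n =
      (r e u n * cnj (r e u n) * S e u (n - 1)) / S e u n * W E u m"
    using W_Suc[OF m(2,3)] m(1) by simp
  also have "\<dots> = W E u m"
    unfolding r_cnj_r[OF assms] using S_nz[OF assms(2)] by simp
  finally show ?thesis
    using m(1) by (metis diff_Suc_1)
qed

lemma stationary_W: "stationary_solution \<gamma> N E (W E u)"
  unfolding stationary_solution_def
proof (intro conjI ballI)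
  show "W E u 0 = cnj (W E u 1)"
    by (rule W_0)
  show "W E u (N + 1) = 0"
    by (simp add: W_def)
  have "W E u 1 * cnj (W E u 1) \<noteq> 0"
    using W_cnj_W[of 1] S_nz[of 1] M_pos M_le_N E_pos by simp
  then show "\<exists>n\<in>{1..N}. W E u n \<noteq> 0"
    using M_pos M_le_N by (intro bexI[of _ 1]) auto
next
  fix n assume "n \<in> {1..N}"
  then have n: "1 \<le> n" "n \<le> N" by auto
  have Suc: "W E u (n + 1) = r e u (n + 1) * W E u n"
  proof (cases "n = N")
    case True
    have "u (RatRe (N+1)) = 0" "u (RatIm (N+1)) = 0"
      using fixed[OF Rat_mem(1), of "N+1"] fixed[OF Rat_mem(2), of "N+1"] M_le_N by simp_all
    then have "r e u (N+1) = 0"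
      using M_le_N by (simp add: r_def)
    then show ?thesis
      using True by (simp add: W_def)
  qed (use W_Suc[of n] n in auto)
  have sq: "of_real ((cmod (W E u n))\<^sup>2) = of_real E * S e u n"
    using W_cnj_W[OF n] by (simp add: complex_norm_square del: of_real_power)
  have "W E u (n + 1) + W E u (n - 1) + \<i> * of_real (\<gamma> n) * W E u n +
      of_real ((cmod (W E u n))\<^sup>2) * W E u n =
    (r e u (n + 1) + cnj (r e u n) * S e u (n - 1) / S e u n + \<i> * of_real (\<gamma> n) + of_real E * S e u n)
      * W E u n"
    unfolding Suc W_pred[OF n] sq by (simp add: algebra_simps)
  also have "\<dots> = of_real E * W E u n"
    unfolding recurrence[OF n] by simp
  finally show "of_real E * W E u n = W E u (n + 1) + W E u (n - 1) + \<i> * of_real (\<gamma> n) * W E u n +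
      of_real ((cmod (W E u n))\<^sup>2) * W E u n" ..
qed

text \<open>Up to sign and scaling, \<open>Amp n\<close> is the very quantity to be bounded, so the
  radius of the polydisc serves as the constant.\<close>

lemma asymptotic_bounds_W:
  assumes "u \<in> polydisc I R"
  shows "asymptotic_bounds N M R E (W E u)"
  unfolding asymptotic_bounds_def
proof (intro conjI ballI)
  fix n assume "n \<in> {1..M}"
  then have n: "1 \<le> n" "n \<le> M" "n \<le> N"
    using M_le_N by auto
  have "complex_of_real ((cmod (W E u n))\<^sup>2 - E) = of_real E * S e u n - of_real E"
    using W_cnj_W[OF n(1,3)] by (simp add: complex_norm_square del: of_real_power)
  also have "\<dots> = - u (Amp n)"
    using n E_e by (simp add: S_def algebra_simps flip: mult.assoc)
  finally have "\<bar>(cmod (W E u n))\<^sup>2 - E\<bar> = norm (u (Amp n))"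
    by (metis norm_minus_cancel norm_of_real)
  then show "\<bar>(cmod (W E u n))\<^sup>2 - E\<bar> \<le> R"
    using assms Amp_mem[OF n(1,3)] by (simp add: polydisc_def)
next
  fix n assume "n \<in> {M+1..N}"
  then have n: "1 \<le> n" "M < n" "n \<le> N"
    by auto
  have "complex_of_real ((cmod (W E u n))\<^sup>2) = of_real E * e * e * u (Amp n)"
    using W_cnj_W[OF n(1,3)] n by (simp add: complex_norm_square S_def del: of_real_power)
  then have "(cmod (W E u n))\<^sup>2 = norm (e * u (Amp n))"
    using E_e by (metis mult_1 norm_of_real abs_of_nonneg zero_le_power2)
  also have "\<dots> = norm (u (Amp n)) / E"
    using E_pos by (simp add: e_def norm_mult norm_divide)
  also have "\<dots> \<le> R / E"
    using assms Amp_mem[OF n(1,3)] E_pos by (intro divide_right_mono) (auto simp: polydisc_def)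
  finally show "(cmod (W E u n))\<^sup>2 \<le> R / E" .
qed

text \<open>The signs can be read off from the solution, which later separates the branches.\<close>

lemma sign_W:
  assumes "1 \<le> n" "n \<le> M"
  shows "\<sigma> n * Re (W E u n * cnj (W E u (n - 1))) > 0"
proof -
  have n: "n \<le> N"
    using assms M_le_N by simp
  have "W E u n * cnj (W E u (n - 1)) = r e u n * S e u (n - 1) / S e u n * (W E u n * cnj (W E u n))"
    unfolding W_pred[OF assms(1) n] using n by (simp add: cnj_simps)
  also have "\<dots> = of_real E * (r e u n * S e u (n - 1))"
    using W_cnj_W[OF assms(1) n] S_nz[OF n] by simp
  also have "\<dots> = of_real E * (X e u n + \<i> * Y e u n)"
    using assms S_large_nz[of "n - 1"] by (simp add: r_def)
  finally have "Re (W E u n * cnj (W E u (n - 1))) = E * Re (X e u n)"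
    using cnj_simps(3)[of n] by (simp add: complex_eq_iff)
  moreover have "\<sigma> n * Re (X e u n) = \<sigma> n * \<sigma> n * sqrt (Re (P e u n))"
    using assms csqrt_P[OF e_real u_real good assms] by (simp add: X_def)
  ultimately have "\<sigma> n * Re (W E u n * cnj (W E u (n - 1))) = E * sqrt (Re (P e u n))"
    by (simp add: sign_sq)
  then show ?thesis
    using good assms E_pos by (simp add: good_def)
qed

end

end

section \<open>From solutions to fixed points\<close>

text \<open>Imaginary and real part of the equation multiplied by \<open>cnj (w n)\<close>.\<close>

lemma stationary_balance:
  assumes "stationary_solution \<gamma> N E w" "1 \<le> n" "n \<le> N"
  shows "Im (w n * cnj (w (n - 1))) = \<gamma> n * (cmod (w n))\<^sup>2 + Im (w (n + 1) * cnj (w n))"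
    and "(E - (cmod (w n))\<^sup>2) * (cmod (w n))\<^sup>2 =
      Re (w (n + 1) * cnj (w n)) + Re (w n * cnj (w (n - 1)))"
proof -
  let ?\<rho> = "(cmod (w n))\<^sup>2"
  have "of_real E * w n = w (n + 1) + w (n - 1) + \<i> * of_real (\<gamma> n) * w n + of_real ?\<rho> * w n"
    using assms unfolding stationary_solution_def by auto
  then have "of_real E * w n * cnj (w n) =
      (w (n + 1) + w (n - 1) + \<i> * of_real (\<gamma> n) * w n + of_real ?\<rho> * w n) * cnj (w n)"
    by (rule arg_cong)
  then have "of_real E * (w n * cnj (w n)) = w (n + 1) * cnj (w n) + cnj (w n * cnj (w (n - 1))) +
      \<i> * of_real (\<gamma> n) * (w n * cnj (w n)) + of_real ?\<rho> * (w n * cnj (w n))"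
    by (simp add: algebra_simps)
  then have *: "of_real (E * ?\<rho>) = w (n + 1) * cnj (w n) + cnj (w n * cnj (w (n - 1))) +
      \<i> * of_real (\<gamma> n * ?\<rho>) + of_real (?\<rho> * ?\<rho>)"
    unfolding complex_norm_square[symmetric] by simp
  show "Im (w n * cnj (w (n - 1))) = \<gamma> n * ?\<rho> + Im (w (n + 1) * cnj (w n))"
    using arg_cong[OF *, of Im] by simp
  show "(E - ?\<rho>) * ?\<rho> = Re (w (n + 1) * cnj (w n)) + Re (w n * cnj (w (n - 1)))"
    using arg_cong[OF *, of Re] by (simp add: algebra_simps)
qed

lemma stationary_flux:
  assumes "stationary_solution \<gamma> N E w" "M \<le> N" "1 \<le> K" "K \<le> M + 1"
  shows "Im (w K * cnj (w (K - 1))) =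
    (\<Sum>k=K..M. \<gamma> k * (cmod (w k))\<^sup>2) + Im (w (M + 1) * cnj (w M))"
  using assms(4)
proof (induction K rule: inc_induct)
  case (step n)
  then have "1 \<le> n" "n \<le> N" "n \<le> M"
    using assms(2,3) by auto
  then have "Im (w n * cnj (w (n - 1))) = \<gamma> n * (cmod (w n))\<^sup>2 + Im (w (Suc n) * cnj (w n))"
    using stationary_balance(1)[OF assms(1), of n] by simp
  also have "Im (w (Suc n) * cnj (w n)) =
      (\<Sum>k=Suc n..M. \<gamma> k * (cmod (w k))\<^sup>2) + Im (w (M + 1) * cnj (w M))"
    using step.IH by (simp only: diff_Suc_1)
  finally show ?case
    using \<open>n \<le> M\<close> by (simp add: sum.atLeast_Suc_atMost)
qed simp

context branch
begin

primrec coord :: "real \<Rightarrow> (nat \<Rightarrow> complex) \<Rightarrow> unknown \<Rightarrow> complex" where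
  "coord E w (Amp n) = of_real (if n \<le> M then E - (cmod (w n))\<^sup>2 else E * (cmod (w n))\<^sup>2)"
| "coord E w (RatRe n) = of_real (E * Re (w n / w (n - 1)))"
| "coord E w (RatIm n) = of_real (E * Im (w n / w (n - 1)))"

lemma coord_real: "coord E w i \<in> \<real>"
  by (cases i) simp_all

text \<open>\<open>E \<ge> 40\<close> makes \<open>E - 32\<close> positive, so block components are
  nonzero, and makes \<open>32 / E\<close> at most 1, so tail components have modulus at most
  1.\<close>

context
  fixes E :: real and w :: "nat \<Rightarrow> complex" and u :: "unknown \<Rightarrow> complex" and e :: complex
  defines "e \<equiv> of_real (1 / E)" and "u \<equiv> coord E w"
  assumes E_ge: "E \<ge> 40" and stat: "stationary_solution \<gamma> N E w"
    and bounds: "asymptotic_bounds N M 32 E w"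
begin

lemma E_pos': "E > 0" and e_nz': "e \<noteq> 0"
  using E_ge by (auto simp: e_def)

lemma w_0: "w 0 = cnj (w 1)" and w_end: "w (Suc N) = 0"
  using stat by (auto simp: stationary_solution_def)

lemma large_bound: "1 \<le> n \<Longrightarrow> n \<le> M \<Longrightarrow> \<bar>(cmod (w n))\<^sup>2 - E\<bar> \<le> 32"
  and small_bound: "M < n \<Longrightarrow> n \<le> N \<Longrightarrow> (cmod (w n))\<^sup>2 \<le> 32 / E"
  using bounds by (auto simp: asymptotic_bounds_def)

lemma w_pred:
  assumes "1 \<le> n" "n \<le> N"
  shows "w (n - 1) = of_real (E - (cmod (w n))\<^sup>2) * w n - \<i> * of_real (\<gamma> n) * w n - w (n + 1)"
proof -
  have "of_real E * w n = w (n + 1) + w (n - 1) + \<i> * of_real (\<gamma> n) * w n + of_real ((cmod (w n))\<^sup>2) * w n"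
    using stat assms unfolding stationary_solution_def by auto
  then show ?thesis
    by (simp add: algebra_simps)
qed

text \<open>In the tail the diagonal coefficient is close to \<open>E\<close> and dominates the
  coupling. Descending from \<open>w (N + 1) = 0\<close>, each component is therefore controlled by
  its left neighbour.\<close>

lemma tail_decay:
  assumes "M < n" "n \<le> N + 1"
  shows "cmod (w n) \<le> 2 / E * cmod (w (n - 1))"
  using assms(2,1)
proof (induction n rule: inc_induct)
  case base
  then show ?case
    using w_end E_pos' by simp
next
  case (step n)
  let ?\<rho> = "(cmod (w n))\<^sup>2"
  define A where "A = of_real (E - ?\<rho>) - \<i> * of_real (\<gamma> n)"
  have n: "1 \<le> n" "n \<le> N"
    using step by auto
  have IH: "cmod (w (n + 1)) \<le> 2 / E * cmod (w n)"
    using step by simp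
  have "32 / E \<le> 1" "2 / E \<le> 1"
    using E_ge by auto
  then have "E / 2 \<le> E - ?\<rho> - 2 / E"
    using small_bound[of n] step.prems n E_ge by linarith
  also have "E - ?\<rho> \<le> cmod A"
    using complex_Re_le_cmod[of A] by (simp add: A_def)
  finally have "E / 2 * cmod (w n) \<le> (cmod A - 2 / E) * cmod (w n)"
    by (intro mult_right_mono) auto
  also have "\<dots> \<le> cmod (A * w n) - cmod (w (n + 1))"
    using IH by (simp add: norm_mult left_diff_distrib)
  also have "\<dots> \<le> cmod (A * w n - w (n + 1))"
    by (rule norm_triangle_ineq2)
  also have "\<dots> = cmod (w (n - 1))"
    using w_pred[OF n] by (simp add: A_def left_diff_distrib)
  finally show ?case
    using E_pos' by (simp add: field_simps)
qed

text \<open>A zero in the tail forces the next component to vanish by \<open>tail_decay\<close>,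
  hence the previous one by the equation; zeros would travel back to the large site
  \<open>M\<close>.\<close>

lemma w_nz: "n \<le> N \<Longrightarrow> w n \<noteq> 0"
proof -
  have large: "w n \<noteq> 0" if "1 \<le> n" "n \<le> M" for n
    using large_bound[OF that] E_ge by auto
  have "w n \<noteq> 0" if "M \<le> n" "n \<le> N" for n
    using that
  proof (induction n rule: nat_induct_at_least)
    case base
    then show ?case
      using large[of M] M_pos by simp
  next
    case (Suc n)
    show ?case
    proof
      assume "w (Suc n) = 0"
      then have "w (Suc (Suc n)) = 0"
        using tail_decay[of "Suc (Suc n)"] Suc by simp
      then have "w n = 0"
        using w_pred[of "Suc n"] Suc.prems \<open>w (Suc n) = 0\<close> by simp
      then show False
        using Suc by simp
    qed
  qed
  moreover have "w 0 \<noteq> 0"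
    using w_0 large[of 1] M_pos by simp
  ultimately show ?thesis if "n \<le> N"
    using large[of n] that by (cases "n = 0"; cases "n \<le> M") (auto simp: Suc_le_eq)
qed

lemma ratio_le:
  assumes "M < n" "n \<le> N + 1"
  shows "cmod (w n / w (n - 1)) \<le> 2 / E"
  using tail_decay[OF assms] w_nz[of "n - 1"] assms by (simp add: norm_divide field_simps)

lemma u_box: "u \<in> polydisc I 32"
  unfolding polydisc_def
proof (intro CollectI ballI)
  fix i assume i: "i \<in> I"
  show "cmod (u i) \<le> 32"
  proof (cases i)
    case (Amp n)
    show ?thesis
    proof (cases "n \<le> M")
      case True
      then show ?thesis
        using large_bound[of n] Amp i unfolding u_def
        by (auto simp: I_def abs_minus_commute simp flip: of_real_diff of_real_power)
    next
      case False
      then show ?thesis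
        using small_bound[of n] Amp i E_pos' unfolding u_def
        by (auto simp: I_def norm_mult norm_power field_simps)
    qed
  next
    case (RatRe n)
    then have "\<bar>Re (w n / w (n - 1))\<bar> \<le> 2 / E"
      using ratio_le[of n] abs_Re_le_cmod[of "w n / w (n - 1)"] i by (auto simp: I_def)
    then have "\<bar>E * Re (w n / w (n - 1))\<bar> \<le> 2"
      using E_pos' by (simp add: abs_mult field_simps del: Re_divide)
    then show ?thesis
      using RatRe by (simp add: u_def norm_mult abs_mult)
  next
    case (RatIm n)
    then have "\<bar>Im (w n / w (n - 1))\<bar> \<le> 2 / E"
      using ratio_le[of n] abs_Im_le_cmod[of "w n / w (n - 1)"] i by (auto simp: I_def)
    then have "\<bar>E * Im (w n / w (n - 1))\<bar> \<le> 2"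
      using E_pos' by (simp add: abs_mult field_simps)
    then show ?thesis
      using RatIm by (simp add: u_def norm_mult abs_mult)
  qed
qed

lemma e_u: "M < n \<Longrightarrow> e * u (Amp n) = of_real ((cmod (w n))\<^sup>2)"
    "e * u (RatRe n) = of_real (Re (w n / w (n - 1)))" "e * u (RatIm n) = of_real (Im (w n / w (n - 1)))"
  using E_pos' by (simp_all add: e_def u_def del: Re_divide Im_divide)

lemma e_E: "e * of_real E = 1"
  using E_pos' by (simp add: e_def)

lemma S_coord:
  assumes "n \<le> N"
  shows "S e u n = e * (w n * cnj (w n))"
proof -
  have *: "S e u n = e * (w n * cnj (w n))" if "1 \<le> n" "n \<le> N" for n
    unfolding complex_norm_square[symmetric]
    using that E_pos' e_u(1)[of n] e_E by (auto simp: S_def u_def max_def right_diff_distrib)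
  show ?thesis
  proof (cases "n = 0")
    case True
    have "S e u 0 = S e u 1"
      using M_pos by (simp add: S_def)
    then show ?thesis
      using True *[of 1] M_pos M_le_N w_0 by simp
  qed (use *[of n] assms in simp)
qed

lemma tail_mult:
  shows "e * u (RatRe (M + 1)) * S e u M = e * of_real (Re (w (M + 1) * cnj (w M)))"
    and "e * u (RatIm (M + 1)) * S e u M = e * of_real (Im (w (M + 1) * cnj (w M)))"
proof -
  define z where "z = w (M + 1) / w M"
  have *: "w (M + 1) * cnj (w M) = z * of_real ((cmod (w M))\<^sup>2)"
    using w_nz[OF M_le_N] unfolding complex_norm_square z_def by simp
  have u: "e * u (RatRe (M + 1)) = of_real (Re z)" "e * u (RatIm (M + 1)) = of_real (Im z)"
    using e_u(2)[of "M + 1"] e_u(3)[of "M + 1"] by (simp_all add: z_def del: Re_divide Im_divide)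
  show "e * u (RatRe (M + 1)) * S e u M = e * of_real (Re (w (M + 1) * cnj (w M)))"
    and "e * u (RatIm (M + 1)) * S e u M = e * of_real (Im (w (M + 1) * cnj (w M)))"
    unfolding u S_coord[OF M_le_N] complex_norm_square[symmetric] * by simp_all
qed

lemma Y_coord:
  assumes "1 \<le> n" "n \<le> M + 1"
  shows "Y e u n = e * of_real (Im (w n * cnj (w (n - 1))))"
proof -
  have "(\<Sum>k=n..M. of_real (\<gamma> k) * S e u k) = (\<Sum>k=n..M. e * of_real (\<gamma> k * (cmod (w k))\<^sup>2))"
    using M_le_N
    by (intro sum.cong) (auto simp: S_coord complex_norm_square simp del: of_real_power)
  then show ?thesis
    unfolding Y_def stationary_flux[OF stat M_le_N assms] tail_mult
    by (simp add: sum_distrib_left ring_distribs)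
qed

lemma P_coord:
  assumes "1 \<le> n" "n \<le> M"
  shows "P e u n = of_real ((Re (w n * cnj (w (n - 1))) / E)\<^sup>2)"
proof -
  let ?z = "w n * cnj (w (n - 1))"
  have "S e u (n - 1) * S e u n = e * e * (?z * cnj ?z)"
    using assms M_le_N S_coord[of n] S_coord[of "n - 1"] by simp
  then have "P e u n = e * e * (?z * cnj ?z - (of_real (Im ?z))\<^sup>2)"
    unfolding P_def using assms by (subst Y_coord) (simp_all only: power2_eq_square, simp_all add: algebra_simps)
  also have "?z * cnj ?z - (of_real (Im ?z))\<^sup>2 = of_real ((Re ?z)\<^sup>2)"
    unfolding complex_mult_cnj by simp
  finally show ?thesis
    by (simp add: e_def power2_eq_square)
qed

context
  assumes signs: "\<And>n. 1 \<le> n \<Longrightarrow> n \<le> M \<Longrightarrow> \<sigma> n * Re (w n * cnj (w (n - 1))) \<ge> 0"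
begin

text \<open>Weak signs suffice: \<open>csqrt\<close> returns the absolute value of the real part
  over \<open>E\<close>, and if that is 0 either sign is right. Hence every solution fits some
  \<open>T\<close>.\<close>

lemma X_coord:
  assumes "1 \<le> n" "n \<le> M + 1"
  shows "X e u n = e * of_real (Re (w n * cnj (w (n - 1))))"
proof (cases "n \<le> M")
  case True
  define x where "x = Re (w n * cnj (w (n - 1)))"
  have "csqrt (P e u n) = of_real (\<bar>x\<bar> / E)"
    unfolding P_coord[OF assms(1) True] x_def[symmetric] using E_pos'
    by (subst csqrt_of_real) (auto simp: abs_divide)
  then have "X e u n = of_real (\<sigma> n * \<bar>x\<bar> / E)"
    using True by (simp add: X_def)
  also have "\<sigma> n * \<bar>x\<bar> = x"
    using signs[OF assms(1) True] unfolding x_def[symmetric]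
    by (cases "n \<in> T") (simp_all add: site_sign_def)
  finally show ?thesis
    by (simp add: e_def x_def)
next
  case False
  then have "n = M + 1"
    using assms by simp
  then show ?thesis
    using tail_mult(1) by (simp add: X_def)
qed

lemma r_coord:
  assumes "1 \<le> n" "n \<le> N"
  shows "r e u n = w n / w (n - 1)"
proof (cases "n \<le> M")
  case True
  define z where "z = w n * cnj (w (n - 1))"
  have "X e u n = e * of_real (Re z)" "Y e u n = e * of_real (Im z)"
    using X_coord[of n] Y_coord[of n] True assms unfolding z_def by auto
  then have "X e u n + \<i> * Y e u n = e * z"
    using complex_eq[of z] by (metis distrib_left mult.left_commute)
  then have "r e u n = e * z / (e * (w (n - 1) * cnj (w (n - 1))))"
    using True S_coord[of "n - 1"] assms by (simp add: r_def)
  also have "\<dots> = w n / w (n - 1)"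
    using w_nz[of "n - 1"] assms e_nz' by (simp add: z_def)
  finally show ?thesis .
next
  case False
  then have "r e u n = of_real (Re (w n / w (n - 1))) + \<i> * of_real (Im (w n / w (n - 1)))"
    unfolding r_def if_not_P[OF False] e_u by simp
  then show ?thesis
    using complex_eq[of "w n / w (n - 1)"] by simp
qed

lemma tail_inverse:
  assumes "M < n" "n \<le> N"
  shows "p e u n - \<i> * q e u n = e * (w (n - 1) / w n)"
    and "p e u n + \<i> * q e u n = cnj (e * (w (n - 1) / w n))"
proof -
  define \<rho> and z where "\<rho> = (cmod (w n))\<^sup>2" and "z = w (n + 1) / w n"
  have "p e u n = e * of_real E - e * of_real \<rho> - e * of_real (Re z)"
    using e_u(1)[OF assms(1)] e_u(2)[of "n+1"] e_E by (simp add: p_def \<rho>_def z_def del: Re_divide)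
  then have p: "p e u n = e * of_real (E - \<rho> - Re z)"
    by (simp add: algebra_simps)
  have "q e u n = e * of_real (\<gamma> n) + e * of_real (Im z)"
    using e_u(3)[of "n+1"] by (simp add: q_def z_def del: Im_divide)
  then have q: "q e u n = e * of_real (\<gamma> n + Im z)"
    by (simp add: algebra_simps)
  have "w (n - 1) / w n = of_real (E - \<rho>) - \<i> * of_real (\<gamma> n) - z"
    using w_pred[of n] w_nz[of n] assms by (simp add: diff_divide_distrib \<rho>_def z_def)
  also have "\<dots> = of_real (E - \<rho> - Re z) - \<i> * of_real (\<gamma> n + Im z)"
    by (simp add: complex_eq_iff)
  finally have *: "w (n - 1) / w n = of_real (E - \<rho> - Re z) - \<i> * of_real (\<gamma> n + Im z)" .
  show "p e u n - \<i> * q e u n = e * (w (n - 1) / w n)"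
    unfolding p q * by (simp add: algebra_simps)
  show "p e u n + \<i> * q e u n = cnj (e * (w (n - 1) / w n))"
    unfolding p q * by (simp add: e_def add_divide_distrib[symmetric])
qed

text \<open>With \<open>Z = E * w n / w (n - 1)\<close> the equation reads
  \<open>p - \<i> * q = 1 / Z\<close>, so \<open>D = 1 / (Z * cnj Z)\<close>, and division of
  \<open>p\<close> and \<open>q\<close> by \<open>D\<close> returns the parts of
  \<open>Z\<close>.\<close>

lemma fixed_coord_small:
  assumes n: "M < n" "n \<le> N"
  shows "u (RatRe n) = p e u n / D e u n" and "u (RatIm n) = q e u n / D e u n"
    and "u (Amp n) = S e u (n - 1) / D e u n"
proof -
  define Z where "Z = of_real E * (w n / w (n - 1))"
  have nz: "w n \<noteq> 0" "w (n - 1) \<noteq> 0"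
    using w_nz n by auto
  then have "Z \<noteq> 0"
    using E_pos' by (simp add: Z_def)
  have "Re Z = E * Re (w n / w (n - 1))" "Im Z = E * Im (w n / w (n - 1))"
    unfolding Z_def by (simp_all only: times_complex.sel Re_complex_of_real Im_complex_of_real)
  then have u: "u (RatRe n) = of_real (Re Z)" "u (RatIm n) = of_real (Im Z)"
    unfolding u_def by simp_all
  have inv: "e * (w (n - 1) / w n) = 1 / Z"
    using nz E_pos' by (simp add: Z_def e_def)
  have D: "D e u n = 1 / (Z * cnj Z)"
    unfolding D_factor tail_inverse[OF n] inv by simp
  have "2 * p e u n = (p e u n - \<i> * q e u n) + (p e u n + \<i> * q e u n)"
    "2 * \<i> * q e u n = (p e u n + \<i> * q e u n) - (p e u n - \<i> * q e u n)"
    by simp_all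
  then have p: "2 * p e u n = 1 / Z + 1 / cnj Z" and q: "2 * \<i> * q e u n = 1 / cnj Z - 1 / Z"
    unfolding tail_inverse[OF n] inv by simp_all
  have "2 * (p e u n / D e u n) = (1 / Z + 1 / cnj Z) * (Z * cnj Z)"
    unfolding D p[symmetric] by simp
  also have "\<dots> = Z + cnj Z"
    using \<open>Z \<noteq> 0\<close> by (simp add: field_simps)
  also have "\<dots> = 2 * u (RatRe n)"
    unfolding complex_add_cnj u by simp
  finally show "u (RatRe n) = p e u n / D e u n"
    by (subst (asm) mult_cancel_left) simp
  have "2 * \<i> * (q e u n / D e u n) = (1 / cnj Z - 1 / Z) * (Z * cnj Z)"
    unfolding D q[symmetric] by simp
  also have "\<dots> = Z - cnj Z"
    using \<open>Z \<noteq> 0\<close> by (simp add: field_simps)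
  also have "\<dots> = 2 * \<i> * u (RatIm n)"
    unfolding complex_diff_cnj u by simp
  finally show "u (RatIm n) = q e u n / D e u n"
    by (subst (asm) mult_cancel_left) simp
  have "S e u (n - 1) / D e u n = e * (w (n - 1) * cnj (w (n - 1))) * (Z * cnj Z)"
    using S_coord[of "n - 1"] n unfolding D by simp
  also have "\<dots> = e * of_real E * (of_real E * (w n * cnj (w n)))"
    using nz by (simp add: Z_def)
  also have "\<dots> = u (Amp n)"
    unfolding e_E complex_norm_square[symmetric] using n by (simp add: u_def)
  finally show "u (Amp n) = S e u (n - 1) / D e u n" ..
qed

lemma fixed_coord:
  assumes "i \<in> I"
  shows "u i = F i e u"
proof (cases i)
  case (Amp n)
  then have n: "1 \<le> n" "n \<le> N"
    using assms by (auto simp: I_def)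
  show ?thesis
  proof (cases "n \<le> M")
    case True
    define \<rho> where "\<rho> = (cmod (w n))\<^sup>2"
    have "\<rho> \<noteq> 0"
      using w_nz[OF n(2)] by (simp add: \<rho>_def)
    have "X e u n + X e u (n + 1) = e * of_real ((E - \<rho>) * \<rho>)"
      unfolding \<rho>_def stationary_balance(2)[OF stat n] using X_coord[of n] X_coord[of "n + 1"] n True
      by (simp add: distrib_left add.commute)
    moreover have "S e u n = e * of_real \<rho>"
      using S_coord[OF n(2)] by (simp add: \<rho>_def complex_norm_square del: of_real_power)
    ultimately show ?thesis
      using Amp True \<open>\<rho> \<noteq> 0\<close> e_nz' by (simp add: u_def \<rho>_def)
  qed (use Amp fixed_coord_small(3)[of n] n in simp)
next
  case (RatRe n)
  show ?thesis
  proof (cases "n \<le> N")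
    case False
    then have "n = Suc N"
      using RatRe assms by (auto simp: I_def)
    then show ?thesis
      using RatRe w_end by (simp add: u_def)
  qed (use RatRe fixed_coord_small(1)[of n] assms in \<open>auto simp: I_def\<close>)
next
  case (RatIm n)
  show ?thesis
  proof (cases "n \<le> N")
    case False
    then have "n = Suc N"
      using RatIm assms by (auto simp: I_def)
    then show ?thesis
      using RatIm w_end by (simp add: u_def)
  qed (use RatIm fixed_coord_small(2)[of n] assms in \<open>auto simp: I_def\<close>)
qed

text \<open>The coordinates determine \<open>(w 1)\<^sup>2\<close> and all ratios; the remaining
  sign of \<open>w 1\<close> propagates to every site.\<close>

lemma gauge_equivalent_W:
  assumes "good e u"
  shows "gauge_equivalent N w (W E u)"
proof -
  have u_real: "u i \<in> \<real>" for i
    unfolding u_def by (rule coord_real)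
  note W = E_pos' u_real assms[unfolded e_def] fixed_coord[unfolded e_def]
  have "(W E u 1)\<^sup>2 = of_real E * (X e u 1 + \<i> * Y e u 1)"
    unfolding e_def by (rule W_1_sq[OF W])
  also have "X e u 1 + \<i> * Y e u 1 = r e u 1 * S e u 0"
    using M_pos S_coord[of 0] w_nz[of 0] e_nz' by (simp add: r_def)
  also have "\<dots> = e * (w 1 * w 1)"
    using r_coord[of 1] S_coord[of 0] w_nz[of 0] w_0 M_pos M_le_N by simp
  also have "of_real E * (e * (w 1 * w 1)) = (w 1)\<^sup>2"
    using e_E by (simp add: power2_eq_square flip: mult.assoc) (simp add: mult.commute)
  finally have "(w 1)\<^sup>2 = (W E u 1)\<^sup>2"
    by simp
  then have "w 1 = W E u 1 \<or> w 1 = - W E u 1"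
    by (simp only: power2_eq_iff)
  then obtain s :: complex where s: "s = 1 \<or> s = - 1" "w 1 = s * W E u 1"
    by (metis mult_1 mult_minus1)
  have "w n = s * W E u n" if "1 \<le> n" "n \<le> N" for n
    using that
  proof (induction n rule: nat_induct_at_least)
    case (Suc n)
    have "w (Suc n) = r e u (Suc n) * w n"
      using r_coord[of "Suc n"] w_nz[of n] Suc.prems by simp
    moreover have "W E u (Suc n) = r e u (Suc n) * W E u n"
      unfolding e_def using Suc by (intro W_Suc[OF W]) auto
    ultimately show ?case
      using Suc by simp
  qed (rule s(2))
  then show ?thesis
    using s(1) by (auto simp: gauge_equivalent_def)
qed

end

end

end

section \<open>Solution families\<close>

text \<open>\<open>Z\<close> is fixed before the threshold, which is only eventual, so that finitely
  many branches can later share one \<open>E0\<close>.\<close>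

lemma (in branch) branch_exists:
  obtains Z where "\<forall>\<^sub>F E0 in at_top.
    (\<forall>E>E0. stationary_solution \<gamma> N E (Z E) \<and> asymptotic_bounds N M 32 E (Z E) \<and>
      (\<forall>n\<in>{1..M}. \<sigma> n * Re (Z E n * cnj (Z E (n - 1))) > 0) \<and>
      (\<forall>w. stationary_solution \<gamma> N E w \<longrightarrow> asymptotic_bounds N M 32 E w \<longrightarrow>
        (\<forall>n\<in>{1..M}. \<sigma> n * Re (w n * cnj (w (n - 1))) \<ge> 0) \<longrightarrow> gauge_equivalent N w (Z E))) \<and>
    (\<forall>n\<in>{1..N}. smooth_on_ray E0 (\<lambda>E. Z E n))"
proof -
  obtain c where c: "\<And>i. i \<in> I \<Longrightarrow> norm (c i) \<le> 2" "\<And>i. i \<in> I \<Longrightarrow> near_const I (c i) (F i)"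
  proof -
    have "\<forall>i\<in>I. \<exists>c. norm c \<le> 2 \<and> near_const I c (F i)"
      using near_const_F by blast
    then show ?thesis
      using that by metis
  qed
  have "\<forall>\<^sub>F \<eta> in at_right 0. 0 < \<eta> \<and> (\<forall>e u. norm e < \<eta> \<longrightarrow> u \<in> polydisc I 32 \<longrightarrow> good e u)"
    by (intro eventually_conj eventually_at_right_less eventually_good) simp
  then obtain \<delta>0 where \<delta>0: "\<delta>0 > 0" "\<And>e u. norm e < \<delta>0 \<Longrightarrow> u \<in> polydisc I 32 \<Longrightarrow> good e u"
    using eventually_happens' trivial_limit_at_right_real by blast
  have "\<exists>\<delta>>0. \<exists>U. (\<forall>i\<in>I. U i holomorphic_on ball 0 \<delta>) \<and>
    (\<forall>e. norm e < \<delta> \<longrightarrow> (\<lambda>i. U i e) \<in> polydisc I 32 \<and> (\<forall>i\<in>I. U i e = F i e (\<lambda>i. U i e)) \<and>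
      (e \<in> \<real> \<longrightarrow> (\<forall>i\<in>I. U i e \<in> \<real>)) \<and>
      (\<forall>v\<in>polydisc I 32. (\<forall>i\<in>I. v i = F i e v) \<longrightarrow> (\<forall>i\<in>I. v i = U i e)))"
  proof (rule holomorphic_fixed_point)
    show "finite I" "\<delta>0 > 0" "(0 :: real) < 32"
      using finite_I \<delta>0(1) by simp_all
    show "near_const I (c i) (F i)" "norm (c i) < 32" if "i \<in> I" for i
      using c[OF that] by simp_all
    show "F i e u \<in> \<real>" if "norm e < \<delta>0" "e \<in> \<real>" "u \<in> polydisc I 32" "\<And>j. j \<in> I \<Longrightarrow> u j \<in> \<real>"
      "i \<in> I" for e u i
      using F_real[OF that(2,4) \<delta>0(2)[OF that(1,3)] that(5)] .
  qed
  then obtain \<delta> U where \<delta>: "\<delta> > 0" and U_holo: "\<forall>i\<in>I. U i holomorphic_on ball 0 \<delta>" and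
    U: "\<forall>e. norm e < \<delta> \<longrightarrow> (\<lambda>i. U i e) \<in> polydisc I 32 \<and> (\<forall>i\<in>I. U i e = F i e (\<lambda>i. U i e)) \<and>
      (e \<in> \<real> \<longrightarrow> (\<forall>i\<in>I. U i e \<in> \<real>)) \<and>
      (\<forall>v\<in>polydisc I 32. (\<forall>i\<in>I. v i = F i e v) \<longrightarrow> (\<forall>i\<in>I. v i = U i e))"
    by (elim exE conjE)
  note U' = U[THEN spec, THEN mp]
  note U_box = U'[THEN conjunct1]
    and U_fixed = U'[THEN conjunct2, THEN conjunct1, THEN bspec]
    and U_real = U'[THEN conjunct2, THEN conjunct2, THEN conjunct1, THEN mp, THEN bspec]
    and U_unique = U'[THEN conjunct2, THEN conjunct2, THEN conjunct2, THEN bspec, THEN mp, THEN bspec]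
  define Z where "Z = (\<lambda>E. W E (\<lambda>i. U i (of_real (1 / E))))"
  have ev: "\<forall>\<^sub>F \<eta> in at_right 0. \<eta> < \<delta> \<and> \<eta> < \<delta>0 \<and> \<eta> < 1 / 40 \<and> 0 < \<eta> \<and>
    (\<forall>n\<in>{1..N}. \<forall>e u v. norm e < \<eta> \<longrightarrow> u \<in> polydisc I 32 \<longrightarrow> v \<in> polydisc I 32 \<longrightarrow>
      (\<forall>i\<in>I. u i = v i) \<longrightarrow> V e u n = V e v n) \<and>
    (\<forall>n\<in>{1..N}. \<forall>U. (\<forall>i\<in>I. U i holomorphic_on ball 0 \<eta>) \<longrightarrow>
      (\<forall>e\<in>ball 0 \<eta>. (\<lambda>i. U i e) \<in> polydisc I 32) \<longrightarrow> (\<lambda>e. V e (\<lambda>i. U i e) n) holomorphic_on ball 0 \<eta>)"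
  proof (intro eventually_conj eventually_ball_finite ballI)
    fix n assume "n \<in> {1..N}"
    then obtain c where c: "near_const I c (\<lambda>e u. V e u n)"
      using near_const_V by auto
    show "\<forall>\<^sub>F \<eta> in at_right 0. \<forall>e u v. norm e < \<eta> \<longrightarrow> u \<in> polydisc I 32 \<longrightarrow> v \<in> polydisc I 32 \<longrightarrow>
      (\<forall>i\<in>I. u i = v i) \<longrightarrow> V e u n = V e v n"
      by (rule near_const_local[OF c]) simp
    show "\<forall>\<^sub>F \<eta> in at_right 0. \<forall>U. (\<forall>i\<in>I. U i holomorphic_on ball 0 \<eta>) \<longrightarrow>
      (\<forall>e\<in>ball 0 \<eta>. (\<lambda>i. U i e) \<in> polydisc I 32) \<longrightarrow> (\<lambda>e. V e (\<lambda>i. U i e) n) holomorphic_on ball 0 \<eta>"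
      by (rule near_const_holomorphic[OF c]) simp
  qed (use \<delta> \<delta>0(1) in \<open>auto simp: eventually_at_right_field intro: exI[of _ "1 / 40"]\<close>)
  show ?thesis
  proof (rule that)
    show "\<forall>\<^sub>F E0 in at_top.
      (\<forall>E>E0. stationary_solution \<gamma> N E (Z E) \<and> asymptotic_bounds N M 32 E (Z E) \<and>
        (\<forall>n\<in>{1..M}. \<sigma> n * Re (Z E n * cnj (Z E (n - 1))) > 0) \<and>
        (\<forall>w. stationary_solution \<gamma> N E w \<longrightarrow> asymptotic_bounds N M 32 E w \<longrightarrow>
          (\<forall>n\<in>{1..M}. \<sigma> n * Re (w n * cnj (w (n - 1))) \<ge> 0) \<longrightarrow> gauge_equivalent N w (Z E))) \<and>
      (\<forall>n\<in>{1..N}. smooth_on_ray E0 (\<lambda>E. Z E n))"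
      \<comment> \<open>The disc has radius \<open>inverse E0\<close>, so every
        \<open>E > E0\<close> gives a parameter \<open>1 / E\<close> inside it.\<close>
      using eventually_compose_filterlim[OF ev filterlim_inverse_at_right_top]
    proof (eventually_elim, intro conjI allI impI ballI)
      fix E0 :: real
      assume E0: "inverse E0 < \<delta> \<and> inverse E0 < \<delta>0 \<and> inverse E0 < 1 / 40 \<and> 0 < inverse E0 \<and>
        (\<forall>n\<in>{1..N}. \<forall>e u v. norm e < inverse E0 \<longrightarrow> u \<in> polydisc I 32 \<longrightarrow> v \<in> polydisc I 32 \<longrightarrow>
          (\<forall>i\<in>I. u i = v i) \<longrightarrow> V e u n = V e v n) \<and>
        (\<forall>n\<in>{1..N}. \<forall>U. (\<forall>i\<in>I. U i holomorphic_on ball 0 (inverse E0)) \<longrightarrow>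
          (\<forall>e\<in>ball 0 (inverse E0). (\<lambda>i. U i e) \<in> polydisc I 32) \<longrightarrow>
          (\<lambda>e. V e (\<lambda>i. U i e) n) holomorphic_on ball 0 (inverse E0))"
      have E0_pos: "E0 > 0"
        using E0 by simp
      have E0_ge: "E0 > 40"
        using E0 E0_pos by (simp add: field_simps)
      {
        fix E assume E: "E > E0"
        let ?e = "complex_of_real (1 / E)"
        let ?u = "\<lambda>i. U i ?e"
        have e: "norm ?e < inverse E0"
          using E E0_pos unfolding norm_of_real by (simp add: field_simps)
        have u: "?u \<in> polydisc I 32"
          using e E0 by (intro U_box) simp
        have W: "E > 0" "\<And>i. i \<in> I \<Longrightarrow> ?u i \<in> \<real>" "good ?e ?u" "\<And>i. i \<in> I \<Longrightarrow> ?u i = F i ?e ?u"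
        proof -
          have "norm ?e < \<delta>" "norm ?e < \<delta>0"
            using e E0 by linarith+
          then show "\<And>i. i \<in> I \<Longrightarrow> ?u i \<in> \<real>" "good ?e ?u" "\<And>i. i \<in> I \<Longrightarrow> ?u i = F i ?e ?u"
            using U_real[of ?e] \<delta>0(2)[OF _ u] by (simp, simp, intro U_fixed)
        qed (use E E0_pos in simp)
        show "stationary_solution \<gamma> N E (Z E)"
          unfolding Z_def by (rule stationary_W[OF W])
        show "asymptotic_bounds N M 32 E (Z E)"
          unfolding Z_def by (rule asymptotic_bounds_W[OF W u])
        show "0 < \<sigma> n * Re (Z E n * cnj (Z E (n - 1)))" if "n \<in> {1..M}" for n
          using that unfolding Z_def by (intro sign_W[OF W]) auto
        fix w assume w: "stationary_solution \<gamma> N E w" "asymptotic_bounds N M 32 E w"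
          "\<forall>n\<in>{1..M}. \<sigma> n * Re (w n * cnj (w (n - 1))) \<ge> 0"
        let ?v = "coord E w"
        have E40: "E \<ge> 40"
          using E E0_ge by simp
        have v: "?v \<in> polydisc I 32"
          by (rule u_box[OF E40 w(1,2)])
        have good: "good ?e ?v"
          using e E0 v by (intro \<delta>0(2)) auto
        \<comment> \<open>Uniqueness gives agreement on \<open>I\<close> only; locality of
          \<open>V\<close> carries it over to the solutions.\<close>
        have "?v i = ?u i" if "i \<in> I" for i
          using fixed_coord[OF E40 w(1,2)] w(3) e E0 v that by (intro U_unique) auto
        then have "V ?e ?v n = V ?e ?u n" if "n \<in> {1..N}" for n
          using E0 e u v that by blast
        then have "W E ?v n = Z E n" if "n \<in> {1..N}" for n
          using that by (simp add: W_def Z_def)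
        moreover have "gauge_equivalent N w (W E ?v)"
          using gauge_equivalent_W[OF E40 w(1,2) _ good] w(3) by simp
        ultimately show "gauge_equivalent N w (Z E)"
          by (simp add: gauge_equivalent_def)
      }
      fix n assume n: "n \<in> {1..N}"
      have sub: "ball 0 (inverse E0) \<subseteq> (ball 0 \<delta> :: complex set)"
        using E0 by (intro subset_ball) simp
      have "\<forall>i\<in>I. U i holomorphic_on ball 0 (inverse E0)"
        using U_holo holomorphic_on_subset[OF _ sub] by blast
      moreover have "\<forall>e\<in>ball 0 (inverse E0). (\<lambda>i. U i e) \<in> polydisc I 32"
        using U_box E0 by auto
      ultimately have V_holo: "(\<lambda>e. V e (\<lambda>i. U i e) n) holomorphic_on ball 0 (inverse E0)"
        using E0 n by blast
      show "smooth_on_ray E0 (\<lambda>E. Z E n)"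
      proof (rule smooth_on_ray_holomorphic)
        \<comment> \<open>\<open>1 / z\<close> maps this half plane into the disc, and
          \<open>csqrt\<close> extends the factor \<open>sqrt E\<close> to it.\<close>
        let ?H = "{z. Re z > E0}"
        have nz: "z \<noteq> 0" if "z \<in> ?H" for z
          using that E0_pos by auto
        have "1 / z \<in> ball 0 (inverse E0)" if "z \<in> ?H" for z
        proof -
          have "E0 < norm z"
            using that complex_Re_le_cmod[of z] by simp
          then show ?thesis
            using E0_pos frac_less2[of 1 1 E0 "norm z"]
            by (simp add: norm_divide inverse_eq_divide)
        qed
        then have "(\<lambda>z. V (1 / z) (\<lambda>i. U i (1 / z)) n) holomorphic_on ?H"
          using nz by (intro holomorphic_on_compose_gen[OF _ V_holo, of "\<lambda>z. 1 / z", unfolded o_def])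
            (auto intro!: holomorphic_intros)
        moreover have "csqrt holomorphic_on ?H"
          using E0_pos by (intro holomorphic_on_subset[OF holomorphic_on_csqrt])
            (auto elim!: nonpos_Reals_cases)
        ultimately show "(\<lambda>z. csqrt z * V (1 / z) (\<lambda>i. U i (1 / z)) n) holomorphic_on ?H"
          by (rule holomorphic_on_mult[rotated])
        show "csqrt (of_real E) * V (1 / of_real E) (\<lambda>i. U i (1 / of_real E)) n = Z E n" if "E > E0" for E
          using that E0_pos n by (simp add: Z_def W_def csqrt_of_real)
      qed
    qed
  qed
qed

text \<open>The branches are indexed by the subsets of \<open>{1..M}\<close>. Strict signs tell them
  apart; weak signs assign every solution to one of them.\<close>

lemma solution_family_exists:
  assumes "1 \<le> M" "M \<le> N" "admissible \<gamma> M"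
  obtains F where "\<forall>\<^sub>F E0 in at_top. solution_family \<gamma> N M E0 32 F \<and>
    (\<forall>E>E0. \<forall>w. stationary_solution \<gamma> N E w \<longrightarrow> asymptotic_bounds N M 32 E w \<longrightarrow>
      (\<exists>i<2 ^ M. gauge_equivalent N w (F i E)))"
proof -
  define weak_signs where "weak_signs = (\<lambda>T w. \<forall>n\<in>{1..M}. site_sign T n * Re (w n * cnj (w (n - 1))) \<ge> (0::real))"
  define strict_signs where "strict_signs = (\<lambda>T w. \<forall>n\<in>{1..M}. site_sign T n * Re (w n * cnj (w (n - 1))) > (0::real))"
  define branch_for where "branch_for = (\<lambda>T Z E0.
    (\<forall>E>E0. stationary_solution \<gamma> N E (Z E) \<and> asymptotic_bounds N M 32 E (Z E) \<and> strict_signs T (Z E) \<and>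
      (\<forall>w. stationary_solution \<gamma> N E w \<longrightarrow> asymptotic_bounds N M 32 E w \<longrightarrow> weak_signs T w \<longrightarrow>
        gauge_equivalent N w (Z E))) \<and>
    (\<forall>n\<in>{1..N}. smooth_on_ray E0 (\<lambda>E. Z E n)))"
  have "\<exists>Z. \<forall>\<^sub>F E0 in at_top. branch_for T Z E0" for T
  proof -
    interpret branch \<gamma> N M T
      using assms by unfold_locales
    show ?thesis
      unfolding branch_for_def weak_signs_def strict_signs_def by (rule branch_exists) (rule exI)
  qed
  then obtain Z where Z: "\<And>T. \<forall>\<^sub>F E0 in at_top. branch_for T (Z T) E0"
    by metis
  obtain h where h: "bij_betw h {0..<2 ^ M :: nat} (Pow {1..M})"
    using ex_bij_betw_nat_finite[of "Pow {1..M}"] by (auto simp: card_Pow)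
  have "\<forall>\<^sub>F E0 in at_top. \<forall>T\<in>Pow {1..M}. branch_for T (Z T) E0"
    using Z by (intro eventually_ball_finite) auto
  then have "\<forall>\<^sub>F E0 in at_top. solution_family \<gamma> N M E0 32 (\<lambda>i. Z (h i)) \<and>
    (\<forall>E>E0. \<forall>w. stationary_solution \<gamma> N E w \<longrightarrow> asymptotic_bounds N M 32 E w \<longrightarrow>
      (\<exists>i<2 ^ M. gauge_equivalent N w (Z (h i) E)))"
  proof eventually_elim
    case (elim E0)
    have Z_props: "stationary_solution \<gamma> N E (Z T E)" "asymptotic_bounds N M 32 E (Z T E)"
        "strict_signs T (Z T E)"
        "stationary_solution \<gamma> N E w \<Longrightarrow> asymptotic_bounds N M 32 E w \<Longrightarrow> weak_signs T w \<Longrightarrow>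
          gauge_equivalent N w (Z T E)"
      if "T \<in> Pow {1..M}" "E > E0" for T E w
      using elim that unfolding branch_for_def by auto
    have Z_smooth: "smooth_on_ray E0 (\<lambda>E. Z T E n)" if "T \<in> Pow {1..M}" "n \<in> {1..N}" for T n
      using elim that unfolding branch_for_def by auto
    have h_mem: "h i \<in> Pow {1..M}" if "i < 2 ^ M" for i
      using bij_betwE[OF h] that by simp
    \<comment> \<open>\<open>w n * cnj (w (n - 1))\<close> is unchanged by the gauge transformation,
      so equivalent solutions have equal signs.\<close>
    have distinct: "\<not> gauge_equivalent N (Z (h i) E) (Z (h j) E)"
      if "E > E0" and ij: "i < 2 ^ M" "j < 2 ^ M" "i \<noteq> j" for E i j
    proof
      assume gauge: "gauge_equivalent N (Z (h i) E) (Z (h j) E)"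
      have "h i \<noteq> h j"
        using h ij unfolding bij_betw_def inj_on_def by (auto simp: atLeast0LessThan)
      then obtain n where n: "n \<in> {1..M}" "n \<in> h i \<longleftrightarrow> n \<notin> h j"
        using h_mem[OF ij(1)] h_mem[OF ij(2)] by blast
      have zero: "Z (h k) E 0 = cnj (Z (h k) E 1)" if "k < 2 ^ M" for k
        using Z_props(1)[OF h_mem[OF that] \<open>E > E0\<close>] unfolding stationary_solution_def by simp
      obtain s :: complex where s: "s = 1 \<or> s = - 1" "\<And>m. m \<in> {1..N} \<Longrightarrow> Z (h i) E m = s * Z (h j) E m"
        using gauge unfolding gauge_equivalent_def by (metis mult_1 mult_minus1)
      have "Z (h i) E (n - 1) = s * Z (h j) E (n - 1)"
      \<comment> \<open>Gauge equivalence speaks of sites \<open>1..N\<close> only; site 0 is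
        reached through \<open>w 0 = cnj (w 1)\<close>.\<close>
      proof (cases "n = 1")
        case True
        then show ?thesis
          using s assms(1,2) zero ij by auto
      next
        case False
        then have "n - 1 \<in> {1..N}"
          using n(1) assms by auto
        then show ?thesis
          by (rule s(2))
      qed
      moreover have "Z (h i) E n = s * Z (h j) E n"
        using s(2) n assms by auto
      ultimately have "Z (h i) E n * cnj (Z (h i) E (n - 1)) = Z (h j) E n * cnj (Z (h j) E (n - 1))"
        using s(1) by auto
      moreover have "site_sign (h i) n = - site_sign (h j) n"
        using n(2) by (auto simp: site_sign_def)
      moreover have "site_sign (h k) n * Re (Z (h k) E n * cnj (Z (h k) E (n - 1))) > 0" if "k < 2 ^ M" for k
        using Z_props(3)[OF h_mem[OF that] \<open>E > E0\<close>] n(1) unfolding strict_signs_def by blast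
      ultimately show False
        using ij by (metis minus_mult_left neg_0_less_iff_less order_less_asym)
    qed
    have complete: "\<exists>i<2 ^ M. gauge_equivalent N w (Z (h i) E)"
      if "E > E0" "stationary_solution \<gamma> N E w" "asymptotic_bounds N M 32 E w" for E w
    proof -
      define T where "T = {n \<in> {1..M}. Re (w n * cnj (w (n - 1))) \<ge> 0}"
      have T: "T \<in> Pow {1..M}"
        by (auto simp: T_def)
      have "weak_signs T w"
        by (auto simp: weak_signs_def T_def site_sign_def)
      then have "gauge_equivalent N w (Z T E)"
        using Z_props(4)[OF T that(1)] that(2,3) by simp
      moreover have "T \<in> h ` {0..<2 ^ M}"
        using T bij_betw_imp_surj_on[OF h] by simp
      then obtain i where "i < 2 ^ M" "h i = T"
        by auto
      ultimately show ?thesis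
        by blast
    qed
    show ?case
      unfolding solution_family_def
      using Z_props(1,2) Z_smooth h_mem distinct complete by auto
  qed
  then show ?thesis
    by (rule that)
qed

section \<open>Classification of the solutions\<close>

text \<open>At a site of maximal modulus \<open>a\<close> both neighbours are at most
  \<open>a\<close>, so \<open>a\<^sup>2\<close> is within 2 of \<open>E\<close>. Elsewhere
  \<open>(|w n|\<^sup>2 - E)\<^sup>2 * |w n|\<^sup>2 \<le> 4 * (E + 2) \<le> 8 * E\<close>; the
  constants 4 and 32 come from dividing by a factor that is at least \<open>E / 2\<close> or
  \<open>(E / 2)\<^sup>2\<close>.\<close>

lemma stationary_dichotomy:
  assumes "stationary_solution \<gamma> N E w" "N \<ge> 1" "E \<ge> 40"
  shows "\<And>n. n \<in> {1..N} \<Longrightarrow> (cmod (w n))\<^sup>2 \<le> E + 2"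
    and "\<And>n. n \<in> {1..N} \<Longrightarrow> (cmod (w n))\<^sup>2 \<ge> E / 2 \<Longrightarrow> \<bar>(cmod (w n))\<^sup>2 - E\<bar> \<le> 4"
    and "\<And>n. n \<in> {1..N} \<Longrightarrow> (cmod (w n))\<^sup>2 < E / 2 \<Longrightarrow> (cmod (w n))\<^sup>2 \<le> 32 / E"
    and "\<exists>n\<in>{1..N}. (cmod (w n))\<^sup>2 \<ge> E / 2"
proof -
  define a where "a = Max ((\<lambda>n. cmod (w n)) ` {1..N})"
  have le_a: "cmod (w n) \<le> a" if "n \<in> {1..N}" for n
    unfolding a_def using that by (intro Max_ge) auto
  have w: "w 0 = cnj (w 1)" "w (N + 1) = 0"
    using assms(1) by (auto simp: stationary_solution_def)
  have "a \<in> (\<lambda>n. cmod (w n)) ` {1..N}"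
    unfolding a_def using assms(2) by (intro Max_in) auto
  then obtain m where m: "m \<in> {1..N}" "cmod (w m) = a"
    by auto
  obtain k where k: "k \<in> {1..N}" "w k \<noteq> 0"
    using assms(1) by (auto simp: stationary_solution_def)
  have "a > 0"
    using le_a[OF k(1)] k(2) by (meson order_less_le_trans zero_less_norm_iff)
  have nbr: "cmod (w (n + 1)) \<le> a" "cmod (w (n - 1)) \<le> a" if "n \<in> {1..N}" for n
  proof -
    show "cmod (w (n + 1)) \<le> a"
      using le_a[of "n + 1"] that w(2) \<open>a > 0\<close> by (cases "n = N") auto
    show "cmod (w (n - 1)) \<le> a"
    proof (cases "n = 1")
      case True
      then show ?thesis
        using le_a[of 1] w(1) assms(2) by simp
    next
      case False
      then show ?thesis
        using that by (intro le_a) auto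
    qed
  qed
  have key: "\<bar>(cmod (w n))\<^sup>2 - E\<bar> * cmod (w n) \<le> 2 * a" if n: "n \<in> {1..N}" for n
  proof -
    \<comment> \<open>\<open>\<gamma> n\<close> enters only the imaginary part, so the modulus is
      still bounded below by the real part.\<close>
    define A where "A = of_real (E - (cmod (w n))\<^sup>2) - \<i> * of_real (\<gamma> n)"
    have "of_real E * w n = w (n + 1) + w (n - 1) + \<i> * of_real (\<gamma> n) * w n + of_real ((cmod (w n))\<^sup>2) * w n"
      using assms(1) n unfolding stationary_solution_def by blast
    then have A: "A * w n = w (n + 1) + w (n - 1)"
      by (simp add: A_def algebra_simps)
    have "\<bar>(cmod (w n))\<^sup>2 - E\<bar> \<le> cmod A"
      using abs_Re_le_cmod[of A] by (simp add: A_def abs_minus_commute)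
    then have "\<bar>(cmod (w n))\<^sup>2 - E\<bar> * cmod (w n) \<le> cmod (A * w n)"
      unfolding norm_mult by (intro mult_right_mono) auto
    also have "\<dots> \<le> 2 * a"
      unfolding A using norm_triangle_ineq[of "w (n + 1)" "w (n - 1)"] nbr[OF n] by linarith
    finally show ?thesis .
  qed
  have a_sq: "\<bar>a\<^sup>2 - E\<bar> \<le> 2"
    using key[OF m(1)] m(2) \<open>a > 0\<close> by simp
  have a_sq_le: "(2 * a)\<^sup>2 \<le> 4 * (E + 2)"
    using a_sq by (simp add: power_mult_distrib)
  have key_sq: "((cmod (w n))\<^sup>2 - E)\<^sup>2 * (cmod (w n))\<^sup>2 \<le> 4 * (E + 2)" if n: "n \<in> {1..N}" for n
  proof -
    have "(\<bar>(cmod (w n))\<^sup>2 - E\<bar> * cmod (w n))\<^sup>2 \<le> (2 * a)\<^sup>2"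
      using key[OF n] by (intro power_mono) auto
    then show ?thesis
      using a_sq_le by (simp add: power_mult_distrib)
  qed
  show "(cmod (w n))\<^sup>2 \<le> E + 2" if "n \<in> {1..N}" for n
    using power_mono[OF le_a[OF that], of 2] a_sq by simp
  show "\<bar>(cmod (w n))\<^sup>2 - E\<bar> \<le> 4" if n: "n \<in> {1..N}" and ge: "(cmod (w n))\<^sup>2 \<ge> E / 2" for n
  proof -
    have "((cmod (w n))\<^sup>2 - E)\<^sup>2 * (E / 2) \<le> ((cmod (w n))\<^sup>2 - E)\<^sup>2 * (cmod (w n))\<^sup>2"
      using ge by (intro mult_left_mono) auto
    also have "\<dots> \<le> 4 * (E + 2)"
      by (rule key_sq[OF n])
    also have "\<dots> \<le> 4\<^sup>2 * (E / 2)"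
      using assms(3) by simp
    finally have "((cmod (w n))\<^sup>2 - E)\<^sup>2 \<le> 4\<^sup>2"
      using assms(3) by (subst (asm) mult_le_cancel_right) auto
    then show ?thesis
      using abs_le_square_iff[of "(cmod (w n))\<^sup>2 - E" 4] by simp
  qed
  show "(cmod (w n))\<^sup>2 \<le> 32 / E" if n: "n \<in> {1..N}" and less: "(cmod (w n))\<^sup>2 < E / 2" for n
  proof -
    have "(E / 2)\<^sup>2 \<le> (E - (cmod (w n))\<^sup>2)\<^sup>2"
      using less assms(3) by (intro power_mono) auto
    then have "(E / 2)\<^sup>2 * (cmod (w n))\<^sup>2 \<le> ((cmod (w n))\<^sup>2 - E)\<^sup>2 * (cmod (w n))\<^sup>2"
      by (intro mult_right_mono) (auto simp: power2_commute)
    also have "\<dots> \<le> 4 * (E + 2)"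
      by (rule key_sq[OF n])
    also have "\<dots> \<le> (E / 2)\<^sup>2 * (32 / E)"
      using assms(3) by (simp add: power2_eq_square)
    finally show ?thesis
      using assms(3) by (subst (asm) mult_le_cancel_left) auto
  qed
  have "(cmod (w m))\<^sup>2 \<ge> E / 2"
    using a_sq m(2) assms(3) by simp
  with m(1) show "\<exists>n\<in>{1..N}. (cmod (w n))\<^sup>2 \<ge> E / 2"
    by blast
qed

text \<open>\<open>E\<close> is fixed here, so nonvanishing becomes a quantitative bound. A small
  neighbour contributes a flux of at most 8 at its end of the block, and replacing
  \<open>|w n|\<^sup>2\<close> by \<open>E\<close> costs at most \<open>4 * G\<close>. Without a
  small left neighbour that flux is at most \<open>E + 2\<close>.\<close>

lemma stationary_pattern:
  assumes st: "stationary_solution \<gamma> N E w" and N: "N \<ge> 1" and E: "E \<ge> 40"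
    and G: "G = (\<Sum>n=1..N. \<bar>\<gamma> n\<bar>)"
    and nonzero: "\<And>K M. 2 \<le> K \<Longrightarrow> K \<le> M \<Longrightarrow> M \<le> N \<Longrightarrow> E * \<bar>\<Sum>n=K..M. \<gamma> n\<bar> > 16 + 4 * G"
  shows "\<exists>M\<in>{1..N}. asymptotic_bounds N M 32 E w \<and>
    (\<forall>K\<in>{1..M}. E * \<bar>\<Sum>n=K..M. \<gamma> n\<bar> \<le> E + 10 + 4 * G)"
proof -
  note dich = stationary_dichotomy[OF st N E]
  define L where "L = {n \<in> {1..N}. (cmod (w n))\<^sup>2 \<ge> E / 2}"
  define M where "M = Max L"
  have L: "finite L" "L \<noteq> {}"
    using dich(4) by (auto simp: L_def)
  then have "M \<in> L"
    unfolding M_def by (rule Max_in)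
  then have M: "1 \<le> M" "M \<le> N"
    by (auto simp: L_def)
  have beyond: "n \<notin> L" if "n > M" for n
    using Max_ge[OF L(1), of n] that by (auto simp: M_def)
  have end_flux: "\<bar>Im (x * cnj y)\<bar> \<le> 8" if "(cmod x)\<^sup>2 \<le> E + 2" "(cmod y)\<^sup>2 \<le> 32 / E" for x y
  proof -
    have "(cmod (x * cnj y))\<^sup>2 \<le> (E + 2) * (32 / E)"
      using that E by (simp only: norm_mult complex_mod_cnj power_mult_distrib) (intro mult_mono; simp)
    also have "\<dots> \<le> 8\<^sup>2"
      using E by (simp add: field_simps)
    finally have "cmod (x * cnj y) \<le> 8"
      by (rule power2_le_imp_le) simp
    then show ?thesis
      using abs_Im_le_cmod[of "x * cnj y"] by linarith
  qed
  have "(cmod (w (M + 1)))\<^sup>2 \<le> 32 / E"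
  proof (cases "M = N")
    case True
    then show ?thesis
      using st E by (simp add: stationary_solution_def)
  next
    case False
    then show ?thesis
      using dich(3)[of "M + 1"] beyond[of "M + 1"] M by (auto simp: L_def)
  qed
  then have right: "\<bar>Im (w (M + 1) * cnj (w M))\<bar> \<le> 8"
    using end_flux[of "w M" "w (M + 1)"] dich(1)[of M] M by (simp add: mult.commute abs_minus_commute)
  have flux: "E * \<bar>\<Sum>n=K..M. \<gamma> n\<bar> \<le> \<bar>Im (w K * cnj (w (K - 1)))\<bar> + 8 + 4 * G"
    if K: "1 \<le> K" "K \<le> M" "{K..M} \<subseteq> L" for K
  proof -
    have "E * (\<Sum>n=K..M. \<gamma> n) + (\<Sum>n=K..M. \<gamma> n * ((cmod (w n))\<^sup>2 - E)) =
        (\<Sum>n=K..M. \<gamma> n * (cmod (w n))\<^sup>2)"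
      unfolding sum_distrib_left sum.distrib[symmetric] by (simp add: algebra_simps)
    also have "\<dots> = Im (w K * cnj (w (K - 1))) - Im (w (M + 1) * cnj (w M))"
      using stationary_flux[OF st M(2), of K] K by simp
    finally have eq: "E * (\<Sum>n=K..M. \<gamma> n) = Im (w K * cnj (w (K - 1))) - Im (w (M + 1) * cnj (w M)) -
        (\<Sum>n=K..M. \<gamma> n * ((cmod (w n))\<^sup>2 - E))"
      by linarith
    have "\<bar>\<Sum>n=K..M. \<gamma> n * ((cmod (w n))\<^sup>2 - E)\<bar> \<le> (\<Sum>n=K..M. \<bar>\<gamma> n\<bar> * 4)"
    proof (rule order.trans[OF sum_abs sum_mono])
      fix n assume "n \<in> {K..M}"
      then have "\<bar>(cmod (w n))\<^sup>2 - E\<bar> \<le> 4"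
        using K(3) dich(2) by (auto simp: L_def)
      then show "\<bar>\<gamma> n * ((cmod (w n))\<^sup>2 - E)\<bar> \<le> \<bar>\<gamma> n\<bar> * 4"
        unfolding abs_mult by (intro mult_left_mono) auto
    qed
    also have "\<dots> \<le> 4 * G"
      unfolding G sum_distrib_right[symmetric] using K M
      by (simp add: sum_mono2)
    finally have "\<bar>E * (\<Sum>n=K..M. \<gamma> n)\<bar> \<le> \<bar>Im (w K * cnj (w (K - 1)))\<bar> + 8 + 4 * G"
      unfolding eq using right by linarith
    then show ?thesis
      using E by (simp add: abs_mult)
  qed
  have all_large: "{1..M} \<subseteq> L"
  proof (rule ccontr)
    assume "\<not> {1..M} \<subseteq> L"
    \<comment> \<open>\<open>j\<close> is the last small site before \<open>M\<close>, so
      \<open>{j+1..M}\<close> is a block of large sites with small neighbours, and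
      \<open>j + 1 \<ge> 2\<close> as the hypothesis requires.\<close>
    define j where "j = Max ({1..M} - L)"
    have "j \<in> {1..M} - L"
      unfolding j_def using \<open>\<not> {1..M} \<subseteq> L\<close> by (intro Max_in) auto
    then have j: "1 \<le> j" "j < M" "j \<notin> L"
      using \<open>M \<in> L\<close> by (auto simp: order.strict_iff_order)
    have sub: "{j+1..M} \<subseteq> L"
    proof
      fix n assume n: "n \<in> {j+1..M}"
      show "n \<in> L"
      proof (rule ccontr)
        assume "n \<notin> L"
        then have "n \<le> j"
          unfolding j_def using n by (intro Max_ge) auto
        then show False
          using n by simp
      qed
    qed
    have "\<bar>Im (w (j + 1) * cnj (w j))\<bar> \<le> 8"
      using end_flux[of "w (j + 1)" "w j"] dich(1)[of "j + 1"] dich(3)[of j] j M by (auto simp: L_def)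
    then have "E * \<bar>\<Sum>n=j+1..M. \<gamma> n\<bar> \<le> 16 + 4 * G"
      using flux[of "j + 1"] j sub by simp
    then show False
      using nonzero[of "j + 1" M] j M by simp
  qed
  show ?thesis
  proof (intro bexI[of _ M] conjI ballI)
    show "M \<in> {1..N}"
      using M by simp
    have "\<bar>(cmod (w n))\<^sup>2 - E\<bar> \<le> 32" if "n \<in> {1..M}" for n
    proof -
      have "n \<in> L"
        using all_large that by blast
      then show ?thesis
        using dich(2)[of n] by (simp add: L_def)
    qed
    moreover have "(cmod (w n))\<^sup>2 \<le> 32 / E" if "n \<in> {M+1..N}" for n
      using dich(3)[of n] beyond[of n] that by (auto simp: L_def)
    ultimately show "asymptotic_bounds N M 32 E w"
      by (simp add: asymptotic_bounds_def)
    fix K assume K: "K \<in> {1..M}"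
    have "cmod (w (K - 1)) \<le> sqrt (E + 2)"
    proof (cases "K = 1")
      case True
      then show ?thesis
        using st dich(1)[of 1] N by (auto simp: stationary_solution_def intro: real_le_rsqrt)
    next
      case False
      then show ?thesis
        using K M by (intro real_le_rsqrt dich(1)) auto
    qed
    moreover have "cmod (w K) \<le> sqrt (E + 2)"
      using dich(1)[of K] K M by (auto intro: real_le_rsqrt)
    ultimately have "cmod (w K) * cmod (w (K - 1)) \<le> sqrt (E + 2) * sqrt (E + 2)"
      using E by (intro mult_mono) auto
    then have "cmod (w K * cnj (w (K - 1))) \<le> E + 2"
      using E by (simp add: norm_mult)
    then have "\<bar>Im (w K * cnj (w (K - 1)))\<bar> \<le> E + 2"
      using abs_Im_le_cmod[of "w K * cnj (w (K - 1))"] by linarith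
    then show "E * \<bar>\<Sum>n=K..M. \<gamma> n\<bar> \<le> E + 10 + 4 * G"
      using flux[of K] K all_large by fastforce
  qed
qed

text \<open>For large \<open>E\<close> a sum exceeding 1 in absolute value violates the flux bound,
  but the value 1 does not; hence the alternative \<open>critical\<close>.\<close>

lemma stationary_classification:
  fixes \<gamma> :: "nat \<Rightarrow> real"
  assumes N: "N \<ge> 1" and nonzero: "\<forall>M\<in>{2..N}. \<forall>K\<in>{2..M}. (\<Sum>n=K..M. \<gamma> n) \<noteq> 0"
  shows "\<forall>\<^sub>F E in at_top. \<forall>w. stationary_solution \<gamma> N E w \<longrightarrow>
    (\<exists>M\<in>{1..N}. asymptotic_bounds N M 32 E w \<and> (admissible \<gamma> M \<or> critical \<gamma> M))"
proof -
  define G where "G = (\<Sum>n=1..N. \<bar>\<gamma> n\<bar>)"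
  have "\<forall>\<^sub>F E in at_top. E * \<bar>\<Sum>n=K..M. \<gamma> n\<bar> > 16 + 4 * G" if "M \<in> {2..N}" "K \<in> {2..M}" for M K
  proof -
    have "LIM E at_top. \<bar>\<Sum>n=K..M. \<gamma> n\<bar> * E :> at_top"
      using nonzero that by (intro filterlim_tendsto_pos_mult_at_top[OF tendsto_const _ filterlim_ident]) auto
    then show ?thesis
      by (simp add: filterlim_at_top_dense mult.commute)
  qed
  then have 1: "\<forall>\<^sub>F E in at_top. \<forall>M\<in>{2..N}. \<forall>K\<in>{2..M}. E * \<bar>\<Sum>n=K..M. \<gamma> n\<bar> > 16 + 4 * G"
    by (intro eventually_ball_finite ballI) auto
  have "\<forall>\<^sub>F E in at_top. \<bar>\<Sum>n=K..M. \<gamma> n\<bar> > 1 \<longrightarrow> E * \<bar>\<Sum>n=K..M. \<gamma> n\<bar> > E + 10 + 4 * G" for M K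
  proof (cases "\<bar>\<Sum>n=K..M. \<gamma> n\<bar> > 1")
    case True
    then have "LIM E at_top. (\<bar>\<Sum>n=K..M. \<gamma> n\<bar> - 1) * E :> at_top"
      by (intro filterlim_tendsto_pos_mult_at_top[OF tendsto_const _ filterlim_ident]) auto
    then have "\<forall>\<^sub>F E in at_top. (\<bar>\<Sum>n=K..M. \<gamma> n\<bar> - 1) * E > 10 + 4 * G"
      by (simp add: filterlim_at_top_dense)
    then show ?thesis
      by eventually_elim (simp add: algebra_simps)
  qed simp
  then have 2: "\<forall>\<^sub>F E in at_top. \<forall>M\<in>{1..N}. \<forall>K\<in>{1..M}. \<bar>\<Sum>n=K..M. \<gamma> n\<bar> > 1 \<longrightarrow>
      E * \<bar>\<Sum>n=K..M. \<gamma> n\<bar> > E + 10 + 4 * G"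
    by (intro eventually_ball_finite ballI) auto
  show ?thesis
    using 1 2 eventually_ge_at_top[of 40]
  proof eventually_elim
    case (elim E)
    show ?case
    proof (intro allI impI)
      fix w assume "stationary_solution \<gamma> N E w"
      moreover have "E * \<bar>\<Sum>n=K..M. \<gamma> n\<bar> > 16 + 4 * G" if "2 \<le> K" "K \<le> M" "M \<le> N" for K M
        using elim(1) that by simp
      ultimately obtain M where M: "M \<in> {1..N}" "asymptotic_bounds N M 32 E w"
        and le: "\<forall>K\<in>{1..M}. E * \<bar>\<Sum>n=K..M. \<gamma> n\<bar> \<le> E + 10 + 4 * G"
        using stationary_pattern[OF _ N elim(3) G_def] by meson
      have "\<bar>\<Sum>n=K..M. \<gamma> n\<bar> \<le> 1" if "K \<in> {1..M}" for K
      proof (rule ccontr)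
        assume "\<not> \<bar>\<Sum>n=K..M. \<gamma> n\<bar> \<le> 1"
        then have "E * \<bar>\<Sum>n=K..M. \<gamma> n\<bar> > E + 10 + 4 * G"
          using elim(2) M(1) that by (meson not_le)
        then show False
          using bspec[OF le that] by linarith
      qed
      then have "admissible \<gamma> M \<or> critical \<gamma> M"
        unfolding admissible_def critical_def by (meson order.not_eq_order_implies_strict)
      with M(1,2) show "\<exists>M\<in>{1..N}. asymptotic_bounds N M 32 E w \<and> (admissible \<gamma> M \<or> critical \<gamma> M)"
        by blast
    qed
  qed
qed

theorem proposition4p1:
  fixes \<gamma> :: "nat \<Rightarrow> real" and N :: nat
  assumes "N \<ge> 1"
    and "\<forall>K\<in>{1..N}. \<bar>\<Sum>n=K..N. \<gamma> n\<bar> < 1"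
    and "\<forall>M\<in>{2..N}. \<forall>K\<in>{2..M}. (\<Sum>n=K..M. \<gamma> n) \<noteq> 0"
  shows "\<exists>(A :: nat \<Rightarrow> real \<Rightarrow> nat \<Rightarrow> complex) (B :: nat \<Rightarrow> nat \<Rightarrow> real \<Rightarrow> nat \<Rightarrow> complex) E0 C.
    E0 > 0 \<and> C > 0 \<and>
    solution_family \<gamma> N N E0 C A \<and>
    (\<forall>M\<in>{1..<N}. admissible \<gamma> M \<longrightarrow> solution_family \<gamma> N M E0 C (B M)) \<and>
    (\<forall>E>E0. \<forall>w. stationary_solution \<gamma> N E w \<longrightarrow>
        (\<exists>i<2 ^ N. gauge_equivalent N w (A i E)) \<or>
        (\<exists>M\<in>{1..<N}. admissible \<gamma> M \<and> (\<exists>i<2 ^ M. gauge_equivalent N w (B M i E))) \<or>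
        (\<exists>M\<in>{1..<N}. critical \<gamma> M \<and> asymptotic_bounds N M C E w))"
proof -
  define complete_family where "complete_family = (\<lambda>M F E0. solution_family \<gamma> N M E0 32 F \<and>
    (\<forall>E>E0. \<forall>w. stationary_solution \<gamma> N E w \<longrightarrow> asymptotic_bounds N M 32 E w \<longrightarrow>
      (\<exists>i<2 ^ M. gauge_equivalent N w (F i E))))"
  have adm_N: "admissible \<gamma> N"
    using assms(2) by (simp add: admissible_def)
  \<comment> \<open>Strict inequalities at \<open>M = N\<close> confine the critical alternative to
    \<open>M < N\<close>.\<close>
  then have crit_N: "\<not> critical \<gamma> N"
    by (auto simp: admissible_def critical_def)
  have "\<exists>F. \<forall>\<^sub>F E0 in at_top. complete_family M F E0" if "M \<in> {1..N}" "admissible \<gamma> M" for M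
    unfolding complete_family_def by (rule solution_family_exists[of M N \<gamma>]) (use that in auto)
  then obtain B where B: "\<And>M. M \<in> {1..N} \<Longrightarrow> admissible \<gamma> M \<Longrightarrow> \<forall>\<^sub>F E0 in at_top. complete_family M (B M) E0"
    by metis
  have "\<forall>\<^sub>F E0 in at_top. \<forall>M\<in>{M\<in>{1..N}. admissible \<gamma> M}. complete_family M (B M) E0"
    using B by (intro eventually_ball_finite) auto
  moreover obtain E1 where E1: "\<And>E w. E \<ge> E1 \<Longrightarrow> stationary_solution \<gamma> N E w \<Longrightarrow>
      \<exists>M\<in>{1..N}. asymptotic_bounds N M 32 E w \<and> (admissible \<gamma> M \<or> critical \<gamma> M)"
    using stationary_classification[OF assms(1,3)] unfolding eventually_at_top_linorder by blast
  ultimately have "\<forall>\<^sub>F E0 in at_top. (\<forall>M\<in>{M\<in>{1..N}. admissible \<gamma> M}. complete_family M (B M) E0) \<and>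
      E0 > 0 \<and> E0 \<ge> E1"
    by (intro eventually_conj eventually_gt_at_top eventually_ge_at_top)
  then obtain E0 where E0: "\<And>M. M \<in> {1..N} \<Longrightarrow> admissible \<gamma> M \<Longrightarrow> complete_family M (B M) E0" "E0 > 0" "E0 \<ge> E1"
    using eventually_happens'[OF trivial_limit_at_top_linorder] by blast
  show ?thesis
  proof (rule exI[of _ "B N"], rule exI[of _ B], rule exI[of _ E0], rule exI[of _ 32],
      intro conjI ballI allI impI)
    show "solution_family \<gamma> N N E0 32 (B N)"
      using E0(1)[of N] adm_N assms(1) by (simp add: complete_family_def)
    show "solution_family \<gamma> N M E0 32 (B M)" if "M \<in> {1..<N}" "admissible \<gamma> M" for M
      using E0(1)[of M] that by (simp add: complete_family_def)
    fix E w assume E: "E > E0" and w: "stationary_solution \<gamma> N E w"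
    then obtain M where M: "M \<in> {1..N}" "asymptotic_bounds N M 32 E w" "admissible \<gamma> M \<or> critical \<gamma> M"
      using E1[of E w] E0(3) by auto
    show "(\<exists>i<2 ^ N. gauge_equivalent N w (B N i E)) \<or>
        (\<exists>M\<in>{1..<N}. admissible \<gamma> M \<and> (\<exists>i<2 ^ M. gauge_equivalent N w (B M i E))) \<or>
        (\<exists>M\<in>{1..<N}. critical \<gamma> M \<and> asymptotic_bounds N M 32 E w)"
    proof (cases "admissible \<gamma> M")
      case True
      then have "\<exists>i<2 ^ M. gauge_equivalent N w (B M i E)"
        using E0(1)[OF M(1) True] E w M(2) unfolding complete_family_def by blast
      then show ?thesis
        using True M(1) by (cases "M = N") auto
    next
      case False
      then have "critical \<gamma> M" "M \<noteq> N"
        using M(3) adm_N by auto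
      then show ?thesis
        using M(1,2) by auto
    qed
  qed (use E0(2) in auto)
qed

end
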